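(* Let $\Omega\subset\mathbb{R}^d$ with $d>1$ be a convex body or a finite union of convex bodies, and let $f:\Omega\to\mathbb{R}$ be a continuous multivariate function. Let $p^*\in\mathcal{P}^T_{d,n}$ be the best polynomial approximation of $f$ in the total degree polynomial space, i.e. $\|f-p^*\|_\Omega\le\|f-p\|_\Omega$ for all $p\in\mathcal{P}^T_{d,n}$. Construct a set of equispaced sample points $\boldsymbol{X}=\{\mathbf{x}_i\}_{1\le i\le M}\subset\Omega$ by an equispaced discretization of $\Omega$ dense enough that the mesh condition given in the context is satisfied, with $M=O(N^2)$, $N=\dim\mathcal{P}^T_{d,n}$. Let $\mathcal{L}(f)$ be the least-squares approximation of $f$ in $\mathcal{P}^T_{d,n}$ obtained by applying the multivariate Vandermonde with Arnoldi (V+A) algorithm with the sample points $\boldsymbol{X}$. Then $$\|f-\mathcal{L}(f)\|_\Omega\le\Big(1+\frac{2}{M}\|\boldsymbol{Q}\boldsymbol{Q}^*\|_\infty\Big)\|f-p^*\|_\Omega\le\big(1+O(N)\big)\|f-p^*\|_\Omega,$$ where the columns of $\boldsymbol{Q}$ are the values, at the sample points $\boldsymbol{X}$, of the discrete orthogonal basis generated by V+A. (The bound for the maximum degree space can be deduced similarly, up to a $d$-dependent constant.)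
   Context: A convex body is a convex compact subset of $\mathbb{R}^d$ with non-empty interior. $\omega(\Omega)$ denotes the minimal distance between two parallel supporting hyperplanes for $\Omega$, and $\mathcal{M}(\Omega)=\frac{4}{\omega(\Omega)}$ for the total degree space. For bounded $g:\Omega\to\mathbb{R}$, $\|g\|_\Omega=\sup_{\mathbf{x}\in\Omega}|g(\mathbf{x})|$. The $O(\cdot)$ notation involves constants that depend on $d$. $\mathcal{P}^T_{d,n}$ is the space of real polynomials in $d$ variables spanned by the monomials $x_{(1)}^{\alpha_1}\cdots x_{(d)}^{\alpha_d}$ with $\sum_{r=1}^d\alpha_r\le n$; $N=\binom{n+d}{n}$. The maximum degree space is spanned by the monomials with $\max_{1\le r\le d}\alpha_r\le n$. Equispaced discretization of a compact set $\Omega\subset\mathbb{R}^d$: take a bounding box (hypercube) $\Omega_{cube}\supset\Omega$, define an equispaced grid of points on $\Omega_{cube}$, and restrict this grid to the points contained in $\Omega$. Mesh condition (for a fixed constant $0<c\le\frac{1}{2\sqrt d}$): for all $\mathbf{x}\in\Omega$, $\inf_{\mathbf{x}_i\in\boldsymbol{X}}\|\mathbf{x}_i-\mathbf{x}\|_\infty\le\frac{c}{\mathcal{M}(\Omega)\,n^2}$. The V+A algorithm runs a Gram–Schmidt (Arnoldi-type) process on suitably ordered monomials to produce a discrete orthogonal basis $\phi_1,\dots,\phi_N$ of $\mathcal{P}^T_{d,n}$, i.e. $\frac1M\sum_{i=1}^M\phi_j(\mathbf{x}_i)\phi_k(\mathbf{x}_i)=\delta_{j,k}$ for $1\le j,k\le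 N$. Thus $\boldsymbol{Q}\in\mathbb{R}^{M\times N}$ has entries $\boldsymbol{Q}_{i,j}=\phi_j(\mathbf{x}_i)$ and $\boldsymbol{Q}^*\boldsymbol{Q}=M\boldsymbol{I}_N$. In exact arithmetic it computes the discrete least-squares approximation $\mathcal{L}(f)=\operatorname{argmin}_{p\in\mathcal{P}^T_{d,n}}\sum_{i=1}^M|f(\mathbf{x}_i)-p(\mathbf{x}_i)|^2$. For a matrix $\boldsymbol{B}$, $\|\boldsymbol{B}\|_\infty=\max_k\sum_i|\boldsymbol{B}_{k,i}|$ is the maximum absolute row sum.
   Formalization: For a union of convex bodies the mesh condition uses the largest 4/ω(K) over the bodies K, not 4/ω(Ω), with which the bound is false; in the existence of X with M=O(N²) the constant may depend on Ω and c, since a d-only constant fails for elongated Ω. For maximum degree M(Ω) gets a factor d². *)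

theory Defs
  imports "HOL-Analysis.Analysis" "Jordan_Normal_Form.Matrix"
begin

no_notation vec_index (infixl "$" 100)

section \<open>Domains\<close>

definition convex_body :: "(real ^ 'd) set \<Rightarrow> bool" where
  "convex_body K \<longleftrightarrow> convex K \<and> compact K \<and> interior K \<noteq> {}"

definition hyperplane :: "real ^ 'd \<Rightarrow> real \<Rightarrow> (real ^ 'd) set" where
  "hyperplane u b = {z. u \<bullet> z = b}"

definition supporting :: "(real ^ 'd) set \<Rightarrow> real ^ 'd \<Rightarrow> real \<Rightarrow> bool" where
  "supporting K u b \<longleftrightarrow> u \<noteq> 0 \<and> K \<inter> hyperplane u b \<noteq> {} \<and>
     ((\<forall>z\<in>K. u \<bullet> z \<le> b) \<or> (\<forall>z\<in>K. u \<bullet> z \<ge> b))"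

definition min_width :: "(real ^ 'd) set \<Rightarrow> real" where
  "min_width K = Inf {setdist (hyperplane u a) (hyperplane u b) | u a b.
     a \<noteq> b \<and> supporting K u a \<and> supporting K u b}"

definition sup_norm_on :: "'a set \<Rightarrow> ('a \<Rightarrow> real) \<Rightarrow> real" where
  "sup_norm_on \<Omega> g = (SUP x\<in>\<Omega>. \<bar>g x\<bar>)"

section \<open>Polynomial spaces\<close>

datatype degree_kind = Total | Maximum

primrec exponents :: "degree_kind \<Rightarrow> nat \<Rightarrow> ('d::finite \<Rightarrow> nat) set" where
  "exponents Total n = {\<alpha>. (\<Sum>r\<in>UNIV. \<alpha> r) \<le> n}"
| "exponents Maximum n = {\<alpha>. \<forall>r. \<alpha> r \<le> n}"

definition monomial :: "('d::finite \<Rightarrow> nat) \<Rightarrow> real ^ 'd \<Rightarrow> real" where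
  "monomial \<alpha> z = (\<Prod>r\<in>UNIV. (z $ r) ^ \<alpha> r)"

text \<open>Polynomials are represented by the functions they induce on the whole space, which
  is faithful because the ground field is infinite.\<close>

definition poly_space :: "degree_kind \<Rightarrow> nat \<Rightarrow> (real ^ 'd::finite \<Rightarrow> real) set" where
  "poly_space T n = {p. \<exists>a. p = (\<lambda>z. \<Sum>\<alpha>\<in>exponents T n. a \<alpha> * monomial \<alpha> z)}"

text \<open>The dimension is the number of spanning monomials (these are linearly independent);
  the type argument carries the number of variables.\<close>

definition space_dim :: "'d::finite itself \<Rightarrow> degree_kind \<Rightarrow> nat \<Rightarrow> nat" where
  "space_dim _ T n = card (exponents T n :: ('d \<Rightarrow> nat) set)"

lemma finite_card_bounded_sum:
  fixes A :: "'d set"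
  assumes "finite A"
  shows "finite {\<alpha> :: 'd \<Rightarrow> nat. (\<forall>r. r \<notin> A \<longrightarrow> \<alpha> r = 0) \<and> sum \<alpha> A \<le> n} \<and>
    card {\<alpha> :: 'd \<Rightarrow> nat. (\<forall>r. r \<notin> A \<longrightarrow> \<alpha> r = 0) \<and> sum \<alpha> A \<le> n} = (n + card A) choose n"
  using assms
proof (induction A arbitrary: n rule: finite_induct)
  case empty
  have "{\<alpha> :: 'd \<Rightarrow> nat. (\<forall>r. r \<notin> {} \<longrightarrow> \<alpha> r = 0) \<and> sum \<alpha> {} \<le> n} = {\<lambda>_. 0}"
    by auto
  then show ?case by simp
next
  case (insert a A)
  define S where "S = (\<lambda>B n. {\<alpha> :: 'd \<Rightarrow> nat. (\<forall>r. r \<notin> B \<longrightarrow> \<alpha> r = 0) \<and> sum \<alpha> B \<le> n})"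
  define g where "g = (\<lambda>j \<alpha>. \<alpha>(a := j) :: 'd \<Rightarrow> nat)"
  have S: "finite (S A n)" "card (S A n) = (n + card A) choose n" for n
    using insert.IH unfolding S_def by auto
  have sum_g: "sum (g j \<alpha>) A = sum \<alpha> A" for j \<alpha>
    using insert.hyps unfolding g_def by (intro sum.cong) auto
  have split: "S (insert a A) n = (\<Union>j\<le>n. g j ` S A (n - j))"
  proof (intro Set.set_eqI iffI)
    fix \<alpha> assume *: "\<alpha> \<in> S (insert a A) n"
    then have "\<alpha> a \<le> n" "g 0 \<alpha> \<in> S A (n - \<alpha> a)"
      using insert.hyps sum_g[of 0 \<alpha>] by (auto simp: S_def g_def)
    moreover have "\<alpha> = g (\<alpha> a) (g 0 \<alpha>)" by (simp add: g_def)
    ultimately show "\<alpha> \<in> (\<Union>j\<le>n. g j ` S A (n - j))" by blast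
  next
    fix \<alpha> assume "\<alpha> \<in> (\<Union>j\<le>n. g j ` S A (n - j))"
    then obtain j \<beta> where *: "j \<le> n" "\<beta> \<in> S A (n - j)" "\<alpha> = g j \<beta>" by blast
    then show "\<alpha> \<in> S (insert a A) n"
      using insert.hyps sum_g[of j \<beta>] by (auto simp: S_def g_def)
  qed
  have inj: "inj_on (g j) (S A m)" for j m
  proof (rule inj_onI)
    fix \<alpha> \<beta> assume *: "\<alpha> \<in> S A m" "\<beta> \<in> S A m" "g j \<alpha> = g j \<beta>"
    have "\<alpha> r = \<beta> r" for r
      using *(1,2) fun_cong[OF *(3), of r] insert.hyps by (cases "r = a") (auto simp: S_def g_def)
    then show "\<alpha> = \<beta>" by blast
  qed
  have "card (S (insert a A) n) = (\<Sum>j\<le>n. card (g j ` S A (n - j)))"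
    unfolding split
  proof (rule card_UN_disjoint)
    show "\<forall>i\<in>{..n}. \<forall>j\<in>{..n}. i \<noteq> j \<longrightarrow> g i ` S A (n - i) \<inter> g j ` S A (n - j) = {}"
      by (auto simp: g_def dest: fun_cong[where x = a])
  qed (use S in auto)
  also have "\<dots> = (\<Sum>j\<le>n. (card A + (n - j)) choose (n - j))"
    by (intro sum.cong) (auto simp: card_image[OF inj] S add.commute)
  also have "\<dots> = (\<Sum>j\<le>n. (card A + j) choose j)"
    using sum.nat_diff_reindex[of "\<lambda>j. (card A + j) choose j" "Suc n"]
    by (simp add: lessThan_Suc_atMost)
  also have "\<dots> = (n + card (insert a A)) choose n"
    using insert.hyps sum_choose_lower[of "card A" n] by (simp add: add.commute)
  finally have "card (S (insert a A) n) = (n + card (insert a A)) choose n" .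
  moreover have "finite (S (insert a A) n)"
    unfolding split using S by auto
  ultimately show ?case unfolding S_def by blast
qed

lemma space_dim_Total: "space_dim TYPE('d::finite) Total n = (n + CARD('d)) choose n"
  using finite_card_bounded_sum[of "UNIV :: 'd set" n] by (simp add: space_dim_def)

definition best_approx ::
  "degree_kind \<Rightarrow> nat \<Rightarrow> (real ^ 'd::finite) set \<Rightarrow> (real ^ 'd \<Rightarrow> real) \<Rightarrow> (real ^ 'd \<Rightarrow> real) \<Rightarrow> bool" where
  "best_approx T n \<Omega> f p \<longleftrightarrow> p \<in> poly_space T n \<and>
     (\<forall>q\<in>poly_space T n. sup_norm_on \<Omega> (\<lambda>z. f z - p z) \<le> sup_norm_on \<Omega> (\<lambda>z. f z - q z))"

section \<open>Sample points\<close>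

text \<open>The constant \<open>\<M>(\<Omega>)\<close> of the domain \<open>\<Omega> = \<Union>\<K>\<close>, a finite union of convex bodies:
  the largest constant \<open>4 / \<omega>(K)\<close> of its constituents, so that it is a Markov constant for the
  union; for a single convex body, \<open>\<K> = {\<Omega>}\<close>, it is \<open>4 / \<omega>(\<Omega>)\<close>. (The width of the union
  itself is the width of its convex hull, which does not control polynomials on the union.)
  A polynomial of maximum degree \<open>n\<close> in \<open>d\<close> variables has total degree at most \<open>d * n\<close>, so
  \<open>(d * n)\<^sup>2\<close> takes the place of \<open>n\<^sup>2\<close>; this is the factor \<open>d\<^sup>2\<close>.\<close>

primrec markov_const :: "degree_kind \<Rightarrow> (real ^ 'd::finite) set set \<Rightarrow> real" where
  "markov_const Total \<K> = Max ((\<lambda>K. 4 / min_width K) ` \<K>)"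
| "markov_const Maximum \<K> = (real CARD('d))\<^sup>2 * Max ((\<lambda>K. 4 / min_width K) ` \<K>)"

text \<open>A hypercube with corner \<open>a\<close> and side \<open>l\<close> containing the domain, and the grid of
  \<open>m + 1\<close> equispaced points along each of its edges.\<close>

definition equispaced_discretization :: "(real ^ 'd::finite) set \<Rightarrow> (real ^ 'd) set \<Rightarrow> bool" where
  "equispaced_discretization \<Omega> X \<longleftrightarrow> (\<exists>a l m. l > 0 \<and> m \<ge> 1 \<and> \<Omega> \<subseteq> cbox a (\<chi> r. a $ r + l) \<and>
     X = \<Omega> \<inter> {\<chi> r. a $ r + l * real (k r) / real m | k :: 'd \<Rightarrow> nat. \<forall>r. k r \<le> m})"

text \<open>Non-emptiness is explicit because \<open>Inf {}\<close> is an unspecified real.\<close>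

definition mesh_condition ::
  "degree_kind \<Rightarrow> nat \<Rightarrow> real \<Rightarrow> (real ^ 'd::finite) set set \<Rightarrow> (real ^ 'd) set \<Rightarrow> bool" where
  "mesh_condition T n c \<K> X \<longleftrightarrow> X \<noteq> {} \<and>
     (\<forall>z\<in>\<Union>\<K>. (INF y\<in>X. infnorm (y - z)) \<le> c / (markov_const T \<K> * (real n)\<^sup>2))"

section \<open>Vandermonde with Arnoldi\<close>

text \<open>Sample points are enumerated as \<open>x 0, ..., x (M - 1)\<close>, and basis functions and exponents
  from \<open>0\<close> to \<open>N - 1\<close>.\<close>

definition discrete_inner ::
  "nat \<Rightarrow> (nat \<Rightarrow> 'a) \<Rightarrow> ('a \<Rightarrow> real) \<Rightarrow> ('a \<Rightarrow> real) \<Rightarrow> real" where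
  "discrete_inner M x g h = (\<Sum>i<M. g (x i) * h (x i)) / real M"

definition raise_exponent :: "'d \<Rightarrow> ('d \<Rightarrow> nat) \<Rightarrow> ('d \<Rightarrow> nat)" where
  "raise_exponent r \<alpha> = \<alpha>(r := Suc (\<alpha> r))"

text \<open>The exponents are listed in the order \<open>\<alpha>\<close>. Step \<open>k\<close> multiplies an earlier basis function
  \<open>\<phi> i\<close> by a coordinate \<open>r\<close> such that the product has the new leading exponent \<open>\<alpha> k\<close>,
  orthogonalises the result against \<open>\<phi> 0, ..., \<phi> (k - 1)\<close>, and normalises it. What makes an
  ordering suitable is that \<open>i\<close> and \<open>r\<close> can be chosen so that all the remaining monomials of the
  product have already been treated. For the total degree space the graded monomial orderings
  have this property, for the maximum degree space the lexicographic ones do. Neither the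
  ordering nor the choice of \<open>i\<close> and \<open>r\<close> is fixed.\<close>

definition va_basis ::
  "degree_kind \<Rightarrow> nat \<Rightarrow> nat \<Rightarrow> (nat \<Rightarrow> real ^ 'd::finite) \<Rightarrow> (nat \<Rightarrow> 'd \<Rightarrow> nat) \<Rightarrow>
     (nat \<Rightarrow> real ^ 'd \<Rightarrow> real) \<Rightarrow> bool" where
  "va_basis T n M x \<alpha> \<phi> \<longleftrightarrow>
     bij_betw \<alpha> {..<space_dim TYPE('d) T n} (exponents T n) \<and>
     \<alpha> 0 = (\<lambda>_. 0) \<and> \<phi> 0 = (\<lambda>_. 1) \<and>
     (\<forall>k\<in>{1..<space_dim TYPE('d) T n}. \<exists>i<k. \<exists>r.
        \<alpha> k = raise_exponent r (\<alpha> i) \<and>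
        (\<forall>j<i. raise_exponent r (\<alpha> j) \<in> \<alpha> ` {..<k}) \<and>
        (let v = (\<lambda>z. z $ r * \<phi> i z);
             w = (\<lambda>z. v z - (\<Sum>j<k. discrete_inner M x v (\<phi> j) * \<phi> j z))
         in \<phi> k = (\<lambda>z. w z / sqrt (discrete_inner M x w w))))"

definition Q_matrix :: "nat \<Rightarrow> nat \<Rightarrow> (nat \<Rightarrow> 'a) \<Rightarrow> (nat \<Rightarrow> 'a \<Rightarrow> real) \<Rightarrow> real Matrix.mat" where
  "Q_matrix M N x \<phi> = Matrix.mat M N (\<lambda>(i, j). \<phi> j (x i))"

definition row_sum_norm :: "real Matrix.mat \<Rightarrow> real" where
  "row_sum_norm B = Max ((\<lambda>k. \<Sum>i<dim_col B. \<bar>B $$ (k, i)\<bar>) ` {..<dim_row B})"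

definition least_squares_approx ::
  "degree_kind \<Rightarrow> nat \<Rightarrow> nat \<Rightarrow> (nat \<Rightarrow> real ^ 'd::finite) \<Rightarrow> (real ^ 'd \<Rightarrow> real) \<Rightarrow>
     (real ^ 'd \<Rightarrow> real) \<Rightarrow> bool" where
  "least_squares_approx T n M x f p \<longleftrightarrow>
     is_arg_min (\<lambda>q. \<Sum>i<M. \<bar>f (x i) - q (x i)\<bar>\<^sup>2) (\<lambda>q. q \<in> poly_space T n) p"

end

theory Submission
  imports Defs "HOL-Computational_Algebra.Polynomial"
begin

text \<open>The sample points form a norming set with constant 2: at a point \<open>z\<close> of \<open>\<Omega>\<close> where a
  polynomial \<open>p\<close> attains its maximum modulus, the multivariate Markov inequality (Wilhelmsen)
  bounds all iterated directional derivatives, and by the mesh condition the Taylor expansion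
  at \<open>z\<close> loses at most half of \<open>\<bar>p z\<bar>\<close> on the way to the nearest sample point, even if that
  point belongs to another of the convex bodies. Hence a polynomial that vanishes on the samples
  is zero, the V+A recursion never divides by zero and yields an orthonormal basis, and least
  squares is the projection \<open>Q Q\<^sup>* / M\<close> on sample values. Applied to \<open>\<L>(f) - p\<^sup>*\<close> this gives
  the first inequality. The second one holds because the row sums of \<open>Q Q\<^sup>*\<close> are at most \<open>M \<surd>M\<close>
  and \<open>\<surd>M = O(N)\<close>.\<close>

text \<open>The constants leave almost no slack. The mesh condition places a sample within Euclidean
  distance \<open>min_width K / (8 * n^2)\<close> of the maximum point, so each derivative in that
  direction costs a factor 1/2 at worst. The plain Taylor bound, the sum of (1/2)^i / i! over i >=
  1, is about 0.65 and exceeds the admissible 1/2. The remedy is in the first order: at a maximum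
  point the Markov constant halves, and 1/4 + 1/8 + 1/16 + ... = 1/2. The maximum may lie on the
  boundary, where only segments that start there are sure to stay in the body. Hence the univariate
  ingredient is an endpoint inequality, with the Chebyshev polynomials as extremal case, rather than
  one for interior points of an interval. Nondegeneracy and triangularity of the V+A basis depend on
  each other: a step can be normalised only if its polynomial is nonzero, which needs the nonzero
  leading coefficients of the earlier steps. Both are therefore proved in one induction.\<close>

no_notation scalar_prod (infix "\<bullet>" 70)

section \<open>The univariate Markov inequality at an endpoint\<close>

fun cheb :: "nat \<Rightarrow> real poly" where
  "cheb 0 = 1"
| "cheb (Suc 0) = [:0, 1:]"
| "cheb (Suc (Suc n)) = [:0, 2:] * cheb (Suc n) - cheb n"

lemma poly_cheb_cos: "poly (cheb n) (cos t) = cos (real n * t)"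
proof (induction n rule: cheb.induct)
  case (3 n)
  have "cos ((real n + 1) * t + t) + cos ((real n + 1) * t - t) = 2 * (cos t * cos ((real n + 1) * t))"
    by (simp add: cos_add cos_diff)
  with 3 show ?case
    by (simp add: algebra_simps)
qed auto

lemma degree_cheb: "Polynomial.degree (cheb n) \<le> n"
proof (induction n rule: cheb.induct)
  case (3 n)
  have "Polynomial.degree ([:0, 2:] * cheb (Suc n)) \<le> Suc (Suc n)"
    using degree_mult_le[of "[:0, 2:]" "cheb (Suc n)"] 3 by auto
  then show ?case
    using 3 by (auto intro: degree_diff_le)
qed auto

lemma poly_cheb_1: "poly (cheb n) 1 = 1"
  using poly_cheb_cos[of n 0] by simp

text \<open>The recurrence, differentiated at 1, becomes (n + 2)^2 = 2 + 2 (n + 1)^2 - n^2. This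
  value is the extremal one in the endpoint inequality.\<close>

lemma poly_pderiv_cheb_1: "poly (pderiv (cheb n)) 1 = (real n)\<^sup>2"
proof (induction n rule: cheb.induct)
  case (3 n)
  then show ?case
    by (simp add: pderiv_diff pderiv_mult pderiv_pCons pderiv_smult poly_cheb_1 power2_eq_square algebra_simps)
qed (auto simp: pderiv_pCons)

text \<open>Turns interlaced zeros into a number of distinct zeros that can be compared with a
  degree.\<close>

lemma card_image_strictly_decreasing:
  fixes w :: "nat \<Rightarrow> real"
  assumes "\<And>k. Suc k < n \<Longrightarrow> w (Suc k) < w k"
  shows "card (w ` {..<n}) = n"
proof -
  have less: "i < j \<Longrightarrow> j < n \<Longrightarrow> w j < w i" for i j
  proof (induction j)
    case (Suc j)
    then show ?case
      using assms[of j] by (cases "i = j") (auto simp: less_Suc_eq)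
  qed simp
  have "inj_on w {..<n}"
  proof (rule inj_onI)
    fix i j assume "i \<in> {..<n}" "j \<in> {..<n}" "w i = w j"
    then show "i = j"
      using less[of i j] less[of j i] by (cases i j rule: linorder_cases) auto
  qed
  then show ?thesis by (simp add: card_image)
qed

text \<open>If the derivative at 1 exceeded that of the Chebyshev polynomial, subtracting the multiple
  of \<open>q\<close> that makes the derivatives at 1 equal would leave a polynomial that still alternates at
  the Chebyshev extrema; Rolle then gives its derivative one zero too many.\<close>

lemma Markov_endpoint_le:
  fixes q :: "real poly"
  assumes deg: "Polynomial.degree q \<le> n" and n: "n \<ge> 1"
    and bound: "\<And>x. -1 \<le> x \<Longrightarrow> x \<le> 1 \<Longrightarrow> \<bar>poly q x\<bar> \<le> 1"
  shows "poly (pderiv q) 1 \<le> (real n)\<^sup>2"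
proof (rule ccontr)
  assume "\<not> ?thesis"
  then have gt: "poly (pderiv q) 1 > (real n)\<^sup>2" by simp
  have n2: "(real n)\<^sup>2 > 0" using n by simp
  define c where "c = (real n)\<^sup>2 / poly (pderiv q) 1"
  have q1: "poly (pderiv q) 1 > 0" using less_trans[OF n2 gt] .
  have c: "0 < c" "c < 1"
    using q1 gt n by (auto simp: c_def)
  define r where "r = cheb n - Polynomial.smult c q"
  have r1: "poly (pderiv r) 1 = 0"
    using q1 by (simp add: r_def pderiv_diff pderiv_smult poly_pderiv_cheb_1 c_def)
  define e where "e k = cos (real k * pi / real n)" for k
  have e_less: "e (Suc k) < e k" if "k < n" for k
  proof -
    have "real (Suc k) * pi \<le> real n * pi" using that by (intro mult_right_mono) auto
    then have "real (Suc k) * pi / real n \<le> pi" using n by (simp add: divide_le_eq mult.commute)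
    then show ?thesis
      unfolding e_def using n by (intro cos_monotone_0_pi) (auto simp: divide_strict_right_mono)
  qed
  have sgn: "(-1) ^ k * poly r (e k) > 0" for k
  proof -
    have "poly (cheb n) (e k) = (-1) ^ k"
      using n by (simp add: e_def poly_cheb_cos)
    moreover have "\<bar>c * poly q (e k)\<bar> < 1"
    proof -
      have "c * \<bar>poly q (e k)\<bar> \<le> c * 1"
        using c bound[of "e k"] by (intro mult_left_mono) (auto simp: e_def)
      also have "\<dots> < 1" using c by simp
      finally show ?thesis using c by (simp add: abs_mult)
    qed
    ultimately show ?thesis
      by (cases "even k") (auto simp: r_def)
  qed
  have "\<exists>y. e (Suc k) < y \<and> y < e k \<and> poly r y = 0" if "k < n" for k
  proof -
    have "poly r (e (Suc k)) * poly r (e k) < 0"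
      using sgn[of k] sgn[of "Suc k"]
      by (cases "even k") (auto simp: mult_less_0_iff)
    then show ?thesis using poly_IVT[OF e_less[OF that]] by blast
  qed
  then obtain y where y: "\<And>k. k < n \<Longrightarrow> e (Suc k) < y k \<and> y k < e k \<and> poly r (y k) = 0"
    by metis
  have y_less: "y (Suc k) < y k" if "Suc k < n" for k
    using y[of k] y[of "Suc k"] that by auto
  have "\<exists>w. y (Suc k) < w \<and> w < y k \<and> poly (pderiv r) w = 0" if "Suc k < n" for k
    using poly_MVT[OF y_less[OF that], of r] y[of k] y[of "Suc k"] that
    by (auto simp: mult_eq_0_iff)
  then obtain w' where w': "\<And>k. Suc k < n \<Longrightarrow>
      y (Suc k) < w' k \<and> w' k < y k \<and> poly (pderiv r) (w' k) = 0"
    by metis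
  \<comment> \<open>Rolle gives n - 1 zeros between the n zeros \<open>y k\<close>; the endpoint 1
    is prepended as one more. These n zeros exceed the degree of \<open>pderiv r\<close>, which is
    at most n - 1.\<close>
  define w where "w k = (case k of 0 \<Rightarrow> 1 | Suc k \<Rightarrow> w' k)" for k
  have w_less: "w (Suc k) < w k" if "Suc k < n" for k
  proof (cases k)
    case 0
    then show ?thesis using w'[of 0] y[of 0] that by (auto simp: w_def e_def)
  next
    case (Suc j)
    then show ?thesis using w'[of j] w'[of k] that by (auto simp: w_def)
  qed
  have w_root: "poly (pderiv r) (w k) = 0" if "k < n" for k
    using r1 w' that by (auto simp: w_def split: nat.split)
  have "pderiv r = 0"
  proof (rule ccontr)
    assume nz: "pderiv r \<noteq> 0"
    have "n = card (w ` {..<n})"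
      using card_image_strictly_decreasing[of n w] w_less by simp
    also have "\<dots> \<le> card {x. poly (pderiv r) x = 0}"
      using w_root nz by (intro card_mono poly_roots_finite) auto
    also have "\<dots> \<le> Polynomial.degree (pderiv r)"
      using nz by (intro card_poly_roots_bound) auto
    also have "\<dots> \<le> n - 1"
      using degree_diff_le[OF degree_cheb[of n], of "Polynomial.smult c q"] deg
      by (auto simp: degree_pderiv r_def intro: diff_le_mono order.trans[OF degree_smult_le])
    finally show False using n by simp
  qed
  then have "Polynomial.degree r = 0" by (simp add: pderiv_eq_0_iff)
  then obtain b where "r = [:b:]" by (metis degree_eq_zeroE)
  \<comment> \<open>A constant cannot be positive at \<open>e 0\<close> and negative at
    \<open>e 1\<close>.\<close>
  then show False using sgn[of 0] sgn[of 1] by simp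
qed

text \<open>The substitution t = (1 - x) / 2 carries the endpoint 1 of [-1, 1] to 0 and halves the
  derivative, hence the factor 2.\<close>

lemma Markov_segment_endpoint:
  fixes q :: "real poly"
  assumes deg: "Polynomial.degree q \<le> n" and n: "n \<ge> 1"
    and bound: "\<And>t. 0 \<le> t \<Longrightarrow> t \<le> 1 \<Longrightarrow> \<bar>poly q t\<bar> \<le> B"
  shows "\<bar>poly (pderiv q) 0\<bar> \<le> 2 * (real n)\<^sup>2 * B"
proof -
  have B: "B \<ge> 0" using bound[of 0] by simp
  \<comment> \<open>The strict bound \<open>b > B\<close> permits division by \<open>b\<close> even
    when \<open>B = 0\<close>; the sign \<open>s\<close> provides the absolute value at the
    end.\<close>
  have *: "s * poly (pderiv q) 0 \<le> 2 * (real n)\<^sup>2 * b" if "b > B" "\<bar>s\<bar> = 1" for b s :: real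
  proof -
    have b: "b > 0" using that B by simp
    define p where "p = Polynomial.smult (- s / b) (pcompose q [:1/2, -1/2:])"
    have "Polynomial.degree p \<le> n"
      using deg b unfolding p_def
      by (intro order.trans[OF degree_smult_le] order.trans[OF degree_pcompose_le]) simp
    moreover have "\<bar>poly p x\<bar> \<le> 1" if "-1 \<le> x" "x \<le> 1" for x
    proof -
      have "\<bar>poly q ((1 - x) / 2)\<bar> \<le> b"
        using bound[of "(1 - x) / 2"] that \<open>b > B\<close> by auto
      moreover have "poly p x = - s / b * poly q ((1 - x) / 2)"
        by (simp add: p_def poly_pcompose diff_divide_distrib)
      ultimately show ?thesis
        using b \<open>\<bar>s\<bar> = 1\<close> by (simp add: abs_mult abs_divide)
    qed
    ultimately have "poly (pderiv p) 1 \<le> (real n)\<^sup>2"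
      using Markov_endpoint_le n by blast
    moreover have "poly (pderiv p) 1 = s * poly (pderiv q) 0 / (2 * b)"
      by (simp add: p_def pderiv_minus pderiv_smult pderiv_pcompose poly_pcompose pderiv_pCons)
    ultimately show ?thesis using b by (simp add: field_simps)
  qed
  have n2: "(real n)\<^sup>2 > 0" using n by simp
  show ?thesis
  proof (rule ccontr)
    assume "\<not> ?thesis"
    then have "B < \<bar>poly (pderiv q) 0\<bar> / (2 * (real n)\<^sup>2)"
      using n2 by (simp add: field_simps)
    then obtain b where b: "B < b" "b < \<bar>poly (pderiv q) 0\<bar> / (2 * (real n)\<^sup>2)"
      using dense by blast
    have "\<bar>poly (pderiv q) 0\<bar> \<le> 2 * (real n)\<^sup>2 * b"
      using *[OF b(1), of 1] *[OF b(1), of "-1"] by auto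
    then show False using b(2) n2 by (simp add: field_simps)
  qed
qed

section \<open>Polynomial functions and widths of convex bodies\<close>

text \<open>The functions of total degree at most \<open>n\<close>, generated without coefficients:
  restriction to lines and differentiation then follow by rule induction.\<close>

inductive poly_fun :: "nat \<Rightarrow> (real ^ 'd::finite \<Rightarrow> real) \<Rightarrow> bool" where
  const: "poly_fun n (\<lambda>_. c)"
| add: "poly_fun n p \<Longrightarrow> poly_fun n q \<Longrightarrow> poly_fun n (\<lambda>z. p z + q z)"
| coord: "poly_fun n p \<Longrightarrow> poly_fun (Suc n) (\<lambda>z. z $ r * p z)"

lemma poly_fun_mono: "poly_fun n p \<Longrightarrow> n \<le> m \<Longrightarrow> poly_fun m p"
proof (induction arbitrary: m rule: poly_fun.induct)
  case (coord n p r)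
  then show ?case using poly_fun.coord[of "m - 1" p r] by (cases m) auto
qed (auto intro: poly_fun.intros)

lemma poly_fun_scale: "poly_fun n p \<Longrightarrow> poly_fun n (\<lambda>z. c * p z)"
proof (induction rule: poly_fun.induct)
  case (coord n p r)
  then show ?case using poly_fun.coord[of n "\<lambda>z. c * p z" r] by (simp add: mult.left_commute)
qed (auto simp: distrib_left intro: poly_fun.intros)

lemma poly_fun_sum:
  "finite S \<Longrightarrow> (\<And>i. i \<in> S \<Longrightarrow> poly_fun n (p i)) \<Longrightarrow> poly_fun n (\<lambda>z. \<Sum>i\<in>S. p i z)"
  by (induction S rule: finite_induct) (auto intro: poly_fun.intros)

lemma poly_fun_coord_power: "poly_fun n p \<Longrightarrow> poly_fun (k + n) (\<lambda>z. (z $ r) ^ k * p z)"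
proof (induction k)
  case (Suc k)
  then show ?case using poly_fun.coord[of "k + n" "\<lambda>z. (z $ r) ^ k * p z" r] by (simp add: mult.assoc)
qed simp

lemma poly_fun_monomial: "poly_fun (\<Sum>r\<in>UNIV. \<alpha> r) (monomial \<alpha>)"
proof -
  have "poly_fun (sum \<alpha> A) (\<lambda>z. \<Prod>r\<in>A. (z $ r) ^ \<alpha> r)" if "finite A" for A
    using that by (induction A rule: finite_induct) (auto intro: poly_fun.const poly_fun_coord_power)
  then show ?thesis by (simp add: monomial_def[abs_def])
qed

text \<open>Restriction to lines makes the univariate Markov inequality, Taylor coefficients and
  root counting available.\<close>

lemma poly_fun_line:
  "poly_fun n p \<Longrightarrow> \<exists>q. Polynomial.degree q \<le> n \<and> (\<forall>t. poly q t = p (z + t *\<^sub>R u))"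
proof (induction rule: poly_fun.induct)
  case (const n c)
  show ?case by (rule exI[of _ "[:c:]"]) simp
next
  case (add n p p')
  then obtain q q' where "Polynomial.degree q \<le> n" "Polynomial.degree q' \<le> n"
    "\<And>t. poly q t = p (z + t *\<^sub>R u)" "\<And>t. poly q' t = p' (z + t *\<^sub>R u)" by blast
  then show ?case by (intro exI[of _ "q + q'"]) (auto intro: degree_add_le)
next
  case (coord n p r)
  then obtain q where q: "Polynomial.degree q \<le> n" "\<And>t. poly q t = p (z + t *\<^sub>R u)" by blast
  have "Polynomial.degree ([:z $ r, u $ r:] * q) \<le> Suc n"
    using q(1) by (intro order.trans[OF degree_mult_le]) auto
  then show ?case using q(2) by (intro exI[of _ "[:z $ r, u $ r:] * q"]) (auto simp: algebra_simps)
qed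

text \<open>The degree of the directional derivatives is kept at \<open>n\<close> rather than
  \<open>n - 1\<close>, because the iterated Markov inequality uses the same factor at every
  order.\<close>

lemma poly_fun_gradient:
  fixes p :: "real ^ 'd::finite \<Rightarrow> real"
  shows "poly_fun n p \<Longrightarrow> \<exists>G. (\<forall>z. (p has_derivative (\<lambda>v. G z \<bullet> v)) (at z)) \<and>
    (\<forall>u. poly_fun n (\<lambda>z. G z \<bullet> u))"
proof (induction rule: poly_fun.induct)
  case (const n c)
  show ?case by (rule exI[of _ "\<lambda>_. 0"]) (auto intro: poly_fun.const)
next
  case (add n p q)
  then obtain G H where "\<And>z. (p has_derivative (\<lambda>v. G z \<bullet> v)) (at z)" "\<And>u. poly_fun n (\<lambda>z. G z \<bullet> u)"
    "\<And>z. (q has_derivative (\<lambda>v. H z \<bullet> v)) (at z)" "\<And>u. poly_fun n (\<lambda>z. H z \<bullet> u)" by blast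
  then show ?case
    by (intro exI[of _ "\<lambda>z. G z + H z"])
      (auto simp: inner_add_left intro: poly_fun.add intro!: derivative_intros)
next
  case (coord n p r)
  then obtain G where G: "\<And>z. (p has_derivative (\<lambda>v. G z \<bullet> v)) (at z)"
    "\<And>u. poly_fun n (\<lambda>z. G z \<bullet> u)" by blast
  have inner: "(p z *\<^sub>R axis r 1 + z $ r *\<^sub>R G z) \<bullet> v = v $ r * p z + z $ r * (G z \<bullet> v)" for z v
    by (simp add: inner_add_left inner_axis' mult.commute)
  have "((\<lambda>z. z $ r * p z) has_derivative (\<lambda>v. v $ r * p z + z $ r * (G z \<bullet> v))) (at z)" for z
    using has_derivative_mult[OF bounded_linear.has_derivative[OF bounded_linear_vec_nth has_derivative_ident] G(1), of r]
    by (simp add: add.commute)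
  moreover have "poly_fun (Suc n) (\<lambda>z. u $ r * p z + z $ r * (G z \<bullet> u))" for u
    using coord.hyps G(2) by (intro poly_fun.add poly_fun.coord poly_fun_mono[OF poly_fun_scale]) auto
  ultimately show ?case
    by (intro exI[of _ "\<lambda>z. p z *\<^sub>R axis r 1 + z $ r *\<^sub>R G z"]) (simp add: inner)
qed

lemma continuous_on_poly_fun: "poly_fun n p \<Longrightarrow> continuous_on S p"
  by (induction rule: poly_fun.induct) (auto intro!: continuous_intros)

lemma poly_pderiv_line:
  fixes p :: "real ^ 'd::finite \<Rightarrow> real"
  assumes "(p has_derivative (\<lambda>v. g \<bullet> v)) (at (z + t *\<^sub>R u))"
    and "\<And>t. poly q t = p (z + t *\<^sub>R u)"
  shows "poly (pderiv q) t = g \<bullet> u"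
proof -
  have "((\<lambda>t. z + t *\<^sub>R u) has_derivative (\<lambda>s. s *\<^sub>R u)) (at t)"
    by (auto intro!: derivative_eq_intros)
  from has_derivative_compose[OF this assms(1)]
  have "(poly q has_derivative (\<lambda>s. (g \<bullet> u) * s)) (at t)"
    by (simp add: assms(2)[symmetric] mult.commute)
  then have "(poly q has_real_derivative g \<bullet> u) (at t)"
    by (simp add: has_field_derivative_def)
  then show ?thesis using poly_DERIV DERIV_unique by blast
qed

section \<open>Supporting hyperplanes and the minimal width\<close>

lemma convex_body_contains_cball:
  assumes "convex_body K"
  obtains x e where "e > 0" "cball x e \<subseteq> K"
proof -
  obtain x where "x \<in> interior K" using assms by (auto simp: convex_body_def)
  then show thesis using that by (auto simp: mem_interior_cball)
qed

lemma cball_along: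
  fixes u :: "real ^ 'd::finite"
  assumes "cball x e \<subseteq> K" "e \<ge> 0" "u \<noteq> 0"
  obtains h where "x + h \<in> K" "x - h \<in> K" "u \<bullet> h = e * norm u"
proof
  let ?h = "(e / norm u) *\<^sub>R u"
  have "norm ?h = e" using assms by simp
  then show "x + ?h \<in> K" "x - ?h \<in> K"
    by (auto intro!: subsetD[OF assms(1)] simp: dist_norm)
  show "u \<bullet> ?h = e * norm u"
    using assms(3) by (simp add: power2_norm_eq_inner[symmetric] power2_eq_square)
qed

text \<open>Two distinct parallel supporting hyperplanes must bound \<open>K\<close> from opposite
  sides, since on the same side both values would be the same extremum of the functional. The ball
  then lies between them.\<close>

lemma supporting_gap:
  assumes "cball x e \<subseteq> K" "e \<ge> 0" "supporting K u a" "supporting K u b" "a \<noteq> b"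
  shows "2 * e * norm u \<le> \<bar>a - b\<bar>"
proof -
  have "u \<noteq> 0" using assms by (simp add: supporting_def)
  then obtain h where h: "x + h \<in> K" "x - h \<in> K" "u \<bullet> h = e * norm u"
    using cball_along assms(1,2) by blast
  obtain y where y: "y \<in> K" "u \<bullet> y = a" using assms(3) by (auto simp: supporting_def hyperplane_def)
  obtain w where w: "w \<in> K" "u \<bullet> w = b" using assms(4) by (auto simp: supporting_def hyperplane_def)
  have a: "(\<forall>z\<in>K. u \<bullet> z \<le> a) \<or> (\<forall>z\<in>K. u \<bullet> z \<ge> a)"
    and b: "(\<forall>z\<in>K. u \<bullet> z \<le> b) \<or> (\<forall>z\<in>K. u \<bullet> z \<ge> b)"
    using assms(3,4) by (auto simp: supporting_def)
  consider "\<And>z. z \<in> K \<Longrightarrow> b \<le> u \<bullet> z \<and> u \<bullet> z \<le> a" | "\<And>z. z \<in> K \<Longrightarrow> a \<le> u \<bullet> z \<and> u \<bullet> z \<le> b"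
    using a b y w assms(5) by (metis order.antisym)
  then show ?thesis
  proof cases
    case 1
    from 1[OF h(1)] 1[OF h(2)] h(3) show ?thesis by (simp add: inner_add_right inner_diff_right)
  next
    case 2
    from 2[OF h(1)] 2[OF h(2)] h(3) show ?thesis by (simp add: inner_add_right inner_diff_right)
  qed
qed

lemma convex_body_supporting_pair:
  assumes "convex_body K" "u \<noteq> 0"
  obtains y w where "y \<in> K" "w \<in> K" "u \<bullet> w < u \<bullet> y"
    "supporting K u (u \<bullet> y)" "supporting K u (u \<bullet> w)"
proof -
  obtain x e where x: "e > 0" "cball x e \<subseteq> K" using convex_body_contains_cball assms(1) by blast
  obtain h where h: "x + h \<in> K" "x - h \<in> K" "u \<bullet> h = e * norm u"
    using cball_along[OF x(2)] x(1) assms(2) by (metis less_imp_le)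
  have K: "compact K" "K \<noteq> {}" using assms(1) h(1) by (auto simp: convex_body_def)
  have cont: "continuous_on K (\<lambda>x. u \<bullet> x)" by (intro continuous_intros)
  obtain y where y: "y \<in> K" "\<And>x. x \<in> K \<Longrightarrow> u \<bullet> x \<le> u \<bullet> y"
    using continuous_attains_sup[OF K cont] by blast
  obtain w where w: "w \<in> K" "\<And>x. x \<in> K \<Longrightarrow> u \<bullet> w \<le> u \<bullet> x"
    using continuous_attains_inf[OF K cont] by blast
  have "e * norm u > 0" using x(1) assms(2) by simp
  then have "u \<bullet> w < u \<bullet> y"
    using y(2)[OF h(1)] w(2)[OF h(2)] h(3) by (simp add: inner_add_right inner_diff_right)
  with y w assms(2) show thesis by (intro that[of y w]) (auto simp: supporting_def hyperplane_def)
qed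

text \<open>The hyperplanes through the two extreme points in direction \<open>g\<close> compete in
  the infimum. Shifting \<open>w\<close> along \<open>g\<close> onto the other hyperplane shows that
  they are at most \<open>(g \<bullet> y - g \<bullet> w) / norm g\<close> apart.\<close>

lemma norm_mult_min_width_le:
  fixes K :: "(real ^ 'd::finite) set"
  assumes "convex_body K" "g \<noteq> 0"
  obtains y w where "y \<in> K" "w \<in> K" "norm g * min_width K \<le> g \<bullet> y - g \<bullet> w"
proof -
  obtain y w where yw: "y \<in> K" "w \<in> K" "g \<bullet> w < g \<bullet> y"
    "supporting K g (g \<bullet> y)" "supporting K g (g \<bullet> w)"
    using convex_body_supporting_pair assms by blast
  define a b where ab: "a = g \<bullet> y" "b = g \<bullet> w"
  have "min_width K \<le> setdist (hyperplane g b) (hyperplane g a)"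
    unfolding min_width_def using yw
    by (intro cInf_lower) (force simp: ab intro!: bdd_belowI[of _ 0])+
  also have "\<dots> \<le> dist w (w + ((a - b) / (g \<bullet> g)) *\<^sub>R g)"
    using assms(2) by (intro setdist_le_dist) (auto simp: hyperplane_def ab inner_add_right)
  also have "\<dots> = (a - b) / norm g"
    using yw(3) by (simp add: dist_norm ab power2_norm_eq_inner[symmetric] power2_eq_square)
  finally show ?thesis
    using assms(2) yw(1,2) by (intro that[of y w]) (auto simp: ab field_simps)
qed

text \<open>An inscribed ball of radius \<open>e\<close> keeps any two competing hyperplanes at
  least \<open>2 * e\<close> apart.\<close>

lemma min_width_pos:
  fixes K :: "(real ^ 'd::finite) set"
  assumes "convex_body K"
  shows "min_width K > 0"
proof -
  obtain x e where x: "e > 0" "cball x e \<subseteq> K" using convex_body_contains_cball assms(1) by blast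
  have "2 * e \<le> min_width K"
    unfolding min_width_def
  proof (rule cInf_greatest)
    \<comment> \<open>A lower bound for \<open>Inf\<close> needs a nonempty set, hence some nonzero
      direction; \<open>undefined\<close> stands for an arbitrary coordinate.\<close>
    have "axis undefined 1 \<noteq> (0 :: real ^ 'd)" by (simp add: axis_eq_0_iff)
    then obtain y w :: "real ^ 'd" and u where "u \<bullet> w < u \<bullet> y"
      "supporting K u (u \<bullet> y)" "supporting K u (u \<bullet> w)"
      using convex_body_supporting_pair[OF assms] by metis
    moreover from this have "u \<bullet> y \<noteq> u \<bullet> w" by simp
    ultimately show "{setdist (hyperplane u a) (hyperplane u b) |u a b.
        a \<noteq> b \<and> supporting K u a \<and> supporting K u b} \<noteq> {}"
      by blast
  next
    fix s assume "s \<in> {setdist (hyperplane u a) (hyperplane u b) |u a b.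
      a \<noteq> b \<and> supporting K u a \<and> supporting K u b}"
    then obtain u a b where s: "s = setdist (hyperplane u a) (hyperplane u b)"
      and ab: "a \<noteq> b" "supporting K u a" "supporting K u b" by blast
    have u: "norm u > 0" using ab by (simp add: supporting_def)
    have "2 * e \<le> dist v w" if "v \<in> hyperplane u a" "w \<in> hyperplane u b" for v w
    proof -
      have "2 * e * norm u \<le> \<bar>u \<bullet> (v - w)\<bar>"
        using supporting_gap[OF x(2) _ ab(2,3,1)] x(1) that by (simp add: hyperplane_def inner_diff_right)
      also have "\<dots> \<le> norm u * norm (v - w)" by (rule Cauchy_Schwarz_ineq2)
      finally show ?thesis using u by (simp add: dist_norm mult.commute)
    qed
    moreover have "hyperplane u a \<noteq> {}" "hyperplane u b \<noteq> {}"
      using ab by (auto simp: supporting_def)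
    ultimately show "2 * e \<le> s" unfolding s by (intro le_setdistI) auto
  qed
  then show ?thesis using x(1) by simp
qed

section \<open>Markov inequalities on convex bodies and norming meshes\<close>

text \<open>On the segment from \<open>z\<close> to \<open>y\<close>, parametrised by [0, 1], the
  point \<open>z\<close> is an endpoint, so \<open>z\<close> may lie on the boundary of
  \<open>K\<close>. The bound does not involve the length of the segment.\<close>

lemma Markov_toward:
  fixes p :: "real ^ 'd::finite \<Rightarrow> real"
  assumes p: "poly_fun n p" "n \<ge> 1" and K: "convex K" "z \<in> K" "y \<in> K"
    and bound: "\<And>x. x \<in> K \<Longrightarrow> \<bar>p x\<bar> \<le> B"
    and g: "(p has_derivative (\<lambda>v. g \<bullet> v)) (at z)"
  shows "\<bar>g \<bullet> (y - z)\<bar> \<le> 2 * (real n)\<^sup>2 * B"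
proof -
  obtain q where q: "Polynomial.degree q \<le> n" "\<And>t. poly q t = p (z + t *\<^sub>R (y - z))"
    using poly_fun_line[OF p(1)] by blast
  have "z + t *\<^sub>R (y - z) \<in> K" if "0 \<le> t" "t \<le> 1" for t
    using convexD_alt[OF K that] by (simp add: algebra_simps)
  then have "\<bar>poly (pderiv q) 0\<bar> \<le> 2 * (real n)\<^sup>2 * B"
    using bound q by (intro Markov_segment_endpoint p(2)) auto
  moreover have "poly (pderiv q) 0 = g \<bullet> (y - z)"
    using g q(2) by (intro poly_pderiv_line[of p]) auto
  ultimately show ?thesis by simp
qed

text \<open>The extreme points of \<open>K\<close> in the directions \<open>g\<close> and \<open>- g\<close> are at least the width apart along
  \<open>g\<close>; it suffices to bound the derivative of \<open>p\<close> from \<open>z\<close> towards each of them.\<close>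

lemma Markov_gradient:
  fixes p :: "real ^ 'd::finite \<Rightarrow> real"
  assumes p: "poly_fun n p" "n \<ge> 1" and K: "convex_body K" "z \<in> K"
    and bound: "\<And>x. x \<in> K \<Longrightarrow> \<bar>p x\<bar> \<le> B"
    and g: "(p has_derivative (\<lambda>v. g \<bullet> v)) (at z)"
  shows "norm g * min_width K \<le> 4 * (real n)\<^sup>2 * B"
proof (cases "g = 0")
  case True
  have "B \<ge> 0" using bound[OF K(2)] by simp
  with True show ?thesis by simp
next
  case False
  then obtain y w where yw: "y \<in> K" "w \<in> K" "norm g * min_width K \<le> g \<bullet> y - g \<bullet> w"
    using norm_mult_min_width_le[OF K(1)] by blast
  have "convex K" using K(1) by (simp add: convex_body_def)
  from Markov_toward[OF p this K(2) yw(1) bound g] Markov_toward[OF p this K(2) yw(2) bound g] yw(3)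
  show ?thesis by (simp add: inner_diff_right)
qed

text \<open>At a maximum point \<open>p\<close> cannot increase towards any point of \<open>K\<close>, so one of the two
  directions contributes nothing and the constant is halved.\<close>

lemma Markov_gradient_at_max:
  fixes p :: "real ^ 'd::finite \<Rightarrow> real"
  assumes p: "poly_fun n p" "n \<ge> 1" and K: "convex_body K" "z \<in> K"
    and max: "\<And>x. x \<in> K \<Longrightarrow> \<bar>p x\<bar> \<le> p z"
    and g: "(p has_derivative (\<lambda>v. g \<bullet> v)) (at z)"
  shows "norm g * min_width K \<le> 2 * (real n)\<^sup>2 * p z"
proof (cases "g = 0")
  case True
  have "p z \<ge> 0" using max[OF K(2)] by simp
  with True show ?thesis by simp
next
  case False
  then obtain y w where yw: "y \<in> K" "w \<in> K" "norm g * min_width K \<le> g \<bullet> y - g \<bullet> w"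
    using norm_mult_min_width_le[OF K(1)] by blast
  have cK: "convex K" using K(1) by (simp add: convex_body_def)
  have "g \<bullet> (y - z) \<le> 0"
  proof (rule ccontr)
    assume "\<not> ?thesis"
    then have pos: "g \<bullet> (y - z) > 0" by simp
    obtain q where q: "\<And>t. poly q t = p (z + t *\<^sub>R (y - z))"
      using poly_fun_line[OF p(1)] by blast
    have "poly (pderiv q) 0 = g \<bullet> (y - z)"
      using g q by (intro poly_pderiv_line[of p]) auto
    then obtain d where d: "d > 0" "\<And>h. h > 0 \<Longrightarrow> h < d \<Longrightarrow> poly q 0 < poly q (0 + h)"
      using DERIV_pos_inc_right[OF poly_DERIV[of q 0]] pos by auto
    define h where "h = min (d / 2) 1"
    have h: "h > 0" "h < d" "h \<le> 1" using d(1) by (auto simp: h_def)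
    have "z + h *\<^sub>R (y - z) \<in> K"
      using convexD_alt[OF cK K(2) yw(1), of h] h by (simp add: algebra_simps)
    then show False using max d(2)[OF h(1,2)] q by fastforce
  qed
  with Markov_toward[OF p cK K(2) yw(2) max g] yw(3)
  show ?thesis by (simp add: inner_diff_right)
qed

text \<open>The derivative in direction \<open>u\<close> is again a polynomial function. The
  gradient inequality bounds it at every point of \<open>K\<close>, not only at \<open>z\<close>, so
  it can take the place of \<open>p\<close> in the induction.\<close>

lemma Markov_higher:
  fixes p :: "real ^ 'd::finite \<Rightarrow> real"
  assumes "poly_fun n p" and n: "n \<ge> 1" and K: "convex_body K" "z \<in> K"
    and "\<And>x. x \<in> K \<Longrightarrow> \<bar>p x\<bar> \<le> B" and "\<And>t. poly q t = p (z + t *\<^sub>R u)"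
  shows "\<bar>poly ((pderiv ^^ i) q) 0\<bar> \<le> (4 * (real n)\<^sup>2 * norm u / min_width K) ^ i * B"
  using assms(1,5,6)
proof (induction i arbitrary: p q B)
  case 0
  then show ?case using K(2) by auto
next
  case (Suc i)
  have w: "min_width K > 0" using min_width_pos K(1) .
  obtain G where G: "\<And>z. (p has_derivative (\<lambda>v. G z \<bullet> v)) (at z)" "poly_fun n (\<lambda>z. G z \<bullet> u)"
    using poly_fun_gradient[OF Suc.prems(1)] by blast
  define s where "s = 4 * (real n)\<^sup>2 * norm u / min_width K"
  have "\<bar>G x \<bullet> u\<bar> \<le> s * B" if "x \<in> K" for x
  proof -
    have "\<bar>G x \<bullet> u\<bar> \<le> norm (G x) * norm u" by (rule Cauchy_Schwarz_ineq2)
    also have "norm (G x) \<le> 4 * (real n)\<^sup>2 * B / min_width K"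
      using Markov_gradient[OF Suc.prems(1) n K(1) that Suc.prems(2) G(1)] w by (simp add: field_simps)
    finally show ?thesis by (simp add: s_def mult_right_mono mult_ac)
  qed
  moreover have "poly (pderiv q) t = G (z + t *\<^sub>R u) \<bullet> u" for t
    using G(1) Suc.prems(3) by (rule poly_pderiv_line)
  ultimately have "\<bar>poly ((pderiv ^^ i) (pderiv q)) 0\<bar> \<le> s ^ i * (s * B)"
    unfolding s_def by (intro Suc.IH[OF G(2)])
  then show ?case by (simp add: funpow_swap1 s_def mult_ac)
qed

text \<open>Since \<open>y\<close> may lie outside \<open>K\<close>, the gradient bound on \<open>K\<close> is not enough: the whole Taylor
  expansion at \<open>z\<close> is needed. Its linear term is at most \<open>1/4\<close> of \<open>p z\<close>, and the term of
  order \<open>i\<close> is at most \<open>(1/2)^i / i!\<close> of it.\<close>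

lemma poly_fun_near_max:
  fixes p :: "real ^ 'd::finite \<Rightarrow> real"
  assumes p: "poly_fun n p" "n \<ge> 1" and K: "convex_body K" "z \<in> K"
    and max: "\<And>x. x \<in> K \<Longrightarrow> \<bar>p x\<bar> \<le> p z"
    and near: "8 * (real n)\<^sup>2 * norm (y - z) \<le> min_width K"
  shows "p z \<le> 2 * p y"
proof -
  define B where "B = p z"
  have B: "B \<ge> 0" using max[OF K(2)] by (simp add: B_def)
  have w: "min_width K > 0" using min_width_pos K(1) .
  define u where "u = y - z"
  obtain q where q: "\<And>t. poly q t = p (z + t *\<^sub>R u)"
    using poly_fun_line[OF p(1)] by blast
  define s where "s = 4 * (real n)\<^sup>2 * norm u / min_width K"
  have s: "0 \<le> s" "s \<le> 1 / 2"
    using near w by (auto simp: s_def u_def field_simps)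
  have coeff: "fact i * coeff q i = poly ((pderiv ^^ i) q) 0" for i
    by (simp add: poly_0_coeff_0 coeff_higher_pderiv pochhammer_fact)
  \<comment> \<open>All orders are fitted under the geometric series 1/4 + 1/8 + ..., whose sum is
    the admissible 1/2.\<close>
  have c: "\<bar>coeff q (Suc i)\<bar> \<le> B * (1/2) ^ (i + 2)" for i
  proof (cases i)
    case 0
    obtain g where g: "(p has_derivative (\<lambda>v. g \<bullet> v)) (at z)"
      using poly_fun_gradient[OF p(1)] by blast
    have "\<bar>coeff q (Suc 0)\<bar> = \<bar>g \<bullet> u\<bar>"
      using coeff[of 1] poly_pderiv_line[of p g z 0 u q] g q by simp
    also have "\<dots> \<le> norm g * norm u" by (rule Cauchy_Schwarz_ineq2)
    also have "norm g \<le> 2 * (real n)\<^sup>2 * B / min_width K"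
      using Markov_gradient_at_max[OF p K max g] w by (simp add: B_def field_simps)
    finally have "\<bar>coeff q (Suc 0)\<bar> \<le> s / 2 * B"
      by (simp add: s_def mult_right_mono mult_ac)
    also have "\<dots> \<le> 1 / 4 * B" using s B by (intro mult_right_mono) auto
    finally show ?thesis using 0 by (simp add: power2_eq_square)
  next
    case (Suc j)
    \<comment> \<open>From order two on, the factorial supplies the extra factor 1/2 that the
      maximum property supplies at order one.\<close>
    have "2 \<le> (fact (Suc i) :: real)"
      using fact_mono[of 2 "Suc i", where 'a = real] Suc by (simp add: numeral_2_eq_2)
    then have "2 * \<bar>coeff q (Suc i)\<bar> \<le> fact (Suc i) * \<bar>coeff q (Suc i)\<bar>"
      by (intro mult_right_mono) auto
    also have "\<dots> = \<bar>poly ((pderiv ^^ Suc i) q) 0\<bar>"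
      unfolding coeff[symmetric] by (simp add: abs_mult del: fact_Suc)
    also have "\<dots> \<le> s ^ Suc i * B"
      unfolding s_def B_def using Markov_higher[OF p K max q] .
    also have "\<dots> \<le> (1 / 2) ^ Suc i * B"
      using s B by (intro mult_right_mono power_mono) auto
    finally show ?thesis by (simp add: mult_ac)
  qed
  have geometric: "(\<Sum>i<m. (1/2 :: real) ^ (i + 2)) \<le> 1 / 2" for m
  proof -
    have "(\<Sum>i<m. (1/2 :: real) ^ (i + 2)) = 1 / 2 - (1 / 2) ^ Suc m"
      by (induction m) auto
    then show ?thesis by simp
  qed
  have "p y = poly q 1" using q[of 1] by (simp add: u_def)
  also have "\<dots> = coeff q 0 + (\<Sum>i<Polynomial.degree q. coeff q (Suc i))"
    by (simp add: poly_altdef sum.atMost_shift)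
  finally have "p y = B + (\<Sum>i<Polynomial.degree q. coeff q (Suc i))"
    using q[of 0] by (simp add: B_def poly_0_coeff_0)
  moreover have "\<bar>\<Sum>i<Polynomial.degree q. coeff q (Suc i)\<bar> \<le> (\<Sum>i<Polynomial.degree q. B * (1/2) ^ (i + 2))"
    using c by (intro order.trans[OF sum_abs] sum_mono)
  moreover have "(\<Sum>i<Polynomial.degree q. B * (1/2) ^ (i + 2)) \<le> B * (1 / 2)"
    using geometric B by (simp only: sum_distrib_left[symmetric] mult_left_mono)
  ultimately show ?thesis by (simp add: B_def)
qed

section \<open>Degree bounds and the norming property of the mesh\<close>

primrec total_degree_bound :: "'d::finite itself \<Rightarrow> degree_kind \<Rightarrow> nat \<Rightarrow> nat" where
  "total_degree_bound _ Total n = n"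
| "total_degree_bound _ Maximum n = CARD('d) * n"

lemma finite_exponents: "finite (exponents T n :: ('d::finite \<Rightarrow> nat) set)"
proof -
  have "exponents T n \<subseteq> (UNIV :: 'd set) \<rightarrow>\<^sub>E {..n}"
  proof
    fix \<alpha> :: "'d \<Rightarrow> nat" assume "\<alpha> \<in> exponents T n"
    then have "\<alpha> r \<le> n" for r
      using member_le_sum[of r UNIV \<alpha>] by (cases T) (auto intro: order.trans)
    then show "\<alpha> \<in> UNIV \<rightarrow>\<^sub>E {..n}" by auto
  qed
  then show ?thesis by (rule finite_subset) (auto intro: finite_PiE)
qed

lemma poly_space_poly_fun:
  fixes p :: "real ^ 'd::finite \<Rightarrow> real"
  assumes "p \<in> poly_space T n"
  shows "poly_fun (total_degree_bound TYPE('d) T n) p"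
proof -
  have le: "(\<Sum>r\<in>UNIV. \<alpha> r) \<le> total_degree_bound TYPE('d) T n" if "\<alpha> \<in> exponents T n" for \<alpha> :: "'d \<Rightarrow> nat"
    using that sum_bounded_above[of UNIV \<alpha> n] by (cases T) auto
  obtain a where "p = (\<lambda>z. \<Sum>\<alpha>\<in>exponents T n. a \<alpha> * monomial \<alpha> z)"
    using assms by (auto simp: poly_space_def)
  then show ?thesis
    using le by (auto intro!: poly_fun_sum finite_exponents poly_fun_scale poly_fun_mono[OF poly_fun_monomial])
qed

lemma markov_const_ge:
  fixes \<K> :: "(real ^ 'd::finite) set set"
  assumes "finite \<K>" "K \<in> \<K>" "n \<ge> 1"
  shows "4 / min_width K * (real (total_degree_bound TYPE('d) T n))\<^sup>2 \<le> markov_const T \<K> * (real n)\<^sup>2"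
proof -
  define W where "W = Max ((\<lambda>K. 4 / min_width K) ` \<K>)"
  have "4 / min_width K \<le> W"
    using assms unfolding W_def by (intro Max_ge) auto
  then have "4 / min_width K * a \<le> W * a" if "a \<ge> 0" for a
    using that by (rule mult_right_mono)
  from this[of "(real n)\<^sup>2"] this[of "(real CARD('d) * real n)\<^sup>2"] show ?thesis
    by (cases T) (auto simp: W_def[symmetric] power_mult_distrib mult_ac)
qed

text \<open>The maximum is taken over the whole union, so it is not known in advance which body
  \<open>K\<close> contains it. The maximum in \<open>markov_const\<close> makes the mesh fine
  enough for each of them.\<close>

lemma norming_mesh:
  fixes \<K> :: "(real ^ 'd::finite) set set"
  assumes \<K>: "finite \<K>" "\<And>K. K \<in> \<K> \<Longrightarrow> convex_body K"
    and c: "0 < c" "c \<le> 1 / (2 * sqrt (real CARD('d)))" and n: "n \<ge> 1"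
    and mesh: "mesh_condition T n c \<K> X" "finite X"
    and p: "p \<in> poly_space T n" and z: "z \<in> \<Union>\<K>"
  shows "\<exists>y\<in>X. \<bar>p z\<bar> \<le> 2 * \<bar>p y\<bar>"
proof -
  define D where "D = total_degree_bound TYPE('d) T n"
  have D: "D \<ge> 1" using n by (cases T) (auto simp: D_def Suc_le_eq)
  have pf: "poly_fun D p" unfolding D_def using p by (rule poly_space_poly_fun)
  have "compact (\<Union>\<K>)" using \<K> by (auto simp: convex_body_def intro: compact_Union)
  moreover have "continuous_on (\<Union>\<K>) (\<lambda>z. \<bar>p z\<bar>)"
    by (intro continuous_intros continuous_on_poly_fun[OF pf])
  ultimately obtain z0 where z0: "z0 \<in> \<Union>\<K>" "\<And>x. x \<in> \<Union>\<K> \<Longrightarrow> \<bar>p x\<bar> \<le> \<bar>p z0\<bar>"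
    using continuous_attains_sup[of "\<Union>\<K>" "\<lambda>z. \<bar>p z\<bar>"] z by blast
  obtain K where K: "K \<in> \<K>" "z0 \<in> K" using z0(1) by blast
  have w: "min_width K > 0" using \<K>(2)[OF K(1)] by (rule min_width_pos)
  \<comment> \<open>The sign turns a point of maximum modulus into a point where the polynomial
    itself is maximal and nonnegative.\<close>
  define \<sigma> where "\<sigma> = (if p z0 \<ge> 0 then 1 else -1 :: real)"
  have pf': "poly_fun D (\<lambda>z. \<sigma> * p z)" using pf by (rule poly_fun_scale)
  \<comment> \<open>A finite set attains the infimum, so the mesh condition yields an actual
    sample.\<close>
  have "(INF y\<in>X. infnorm (y - z0)) \<in> (\<lambda>y. infnorm (y - z0)) ` X"
    using mesh by (subst cInf_eq_Min) (auto simp: mesh_condition_def intro!: Min_in)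
  then obtain y where y: "y \<in> X" "infnorm (y - z0) = (INF y\<in>X. infnorm (y - z0))"
    by (metis (no_types, lifting) imageE)
  have "infnorm (y - z0) \<le> c / (markov_const T \<K> * (real n)\<^sup>2)"
    using mesh(1) z0(1) y(2) unfolding mesh_condition_def by metis
  also have "\<dots> \<le> c / (4 / min_width K * (real D)\<^sup>2)"
  proof (rule divide_left_mono)
    show le: "4 / min_width K * (real D)\<^sup>2 \<le> markov_const T \<K> * (real n)\<^sup>2"
      unfolding D_def by (rule markov_const_ge[OF \<K>(1) K(1) n])
    have "0 < 4 / min_width K * (real D)\<^sup>2" using w D by simp
    with le show "0 < markov_const T \<K> * (real n)\<^sup>2 * (4 / min_width K * (real D)\<^sup>2)"
      by (meson less_le_trans mult_pos_pos)
  qed (use c in simp)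
  finally have inf: "infnorm (y - z0) \<le> c * min_width K / (4 * (real D)\<^sup>2)"
    by simp
  have "norm (y - z0) \<le> sqrt (real CARD('d)) * infnorm (y - z0)"
    using norm_le_infnorm[of "y - z0"] by simp
  also have "\<dots> \<le> sqrt (real CARD('d)) * (c * min_width K / (4 * (real D)\<^sup>2))"
    using inf by (intro mult_left_mono) auto
  also have "\<dots> = (sqrt (real CARD('d)) * c) * (min_width K / (4 * (real D)\<^sup>2))" by simp
  \<comment> \<open>The hypothesis on \<open>c\<close> absorbs the factor sqrt d lost between the
    maximum norm and the Euclidean norm; the remaining 1/2 turns 4 into 8.\<close>
  also have "\<dots> \<le> 1 / 2 * (min_width K / (4 * (real D)\<^sup>2))"
    using c w by (intro mult_right_mono) (auto simp: field_simps)
  finally have "8 * (real D)\<^sup>2 * norm (y - z0) \<le> min_width K"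
    using D by (simp add: field_simps)
  moreover have "\<bar>\<sigma> * p x\<bar> \<le> \<sigma> * p z0" if "x \<in> K" for x
    using z0(2)[OF UnionI[OF K(1) that]] by (auto simp: \<sigma>_def abs_mult split: if_splits)
  ultimately have "\<sigma> * p z0 \<le> 2 * (\<sigma> * p y)"
    using poly_fun_near_max[OF pf' D \<K>(2)[OF K(1)] K(2)] by simp
  moreover have "\<sigma> * p z0 = \<bar>p z0\<bar>" "\<sigma> * p y \<le> \<bar>p y\<bar>" by (auto simp: \<sigma>_def)
  ultimately have "\<bar>p z\<bar> \<le> 2 * \<bar>p y\<bar>"
    using z0(2)[OF z] by linarith
  then show ?thesis using y(1) by blast
qed

section \<open>Linear independence of monomials\<close>

text \<open>Induction over the variables in \<open>A\<close>. Varying only the coordinate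
  \<open>r\<^sub>0\<close> gives a univariate polynomial whose coefficients are the sums over the
  exponents with a fixed entry at \<open>r\<^sub>0\<close>, and all of them vanish. The third
  hypothesis says that exponents in \<open>S\<close> are determined by their entries in
  \<open>A\<close>; each group inherits it for the smaller set.\<close>

lemma monomials_independent_on:
  fixes a :: "('d::finite \<Rightarrow> nat) \<Rightarrow> real"
  assumes "finite A" "finite S"
    and "\<And>\<alpha> \<beta>. \<alpha> \<in> S \<Longrightarrow> \<beta> \<in> S \<Longrightarrow> (\<And>r. r \<in> A \<Longrightarrow> \<alpha> r = \<beta> r) \<Longrightarrow> \<alpha> = \<beta>"
    and "\<And>z :: real ^ 'd. (\<Sum>\<alpha>\<in>S. a \<alpha> * (\<Prod>r\<in>A. (z $ r) ^ \<alpha> r)) = 0"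
    and "\<alpha> \<in> S"
  shows "a \<alpha> = 0"
  using assms
proof (induction A arbitrary: S \<alpha> rule: finite_induct)
  case empty
  then have "S = {\<alpha>}" by blast
  then show ?case using empty.prems(3)[of 0] by simp
next
  case (insert r\<^sub>0 A)
  define n where "n = Max ((\<lambda>\<alpha>. \<alpha> r\<^sub>0) ` S)"
  have n: "\<beta> r\<^sub>0 \<le> n" if "\<beta> \<in> S" for \<beta>
    unfolding n_def using that insert.prems(1) by (intro Max_ge) auto
  define S' where "S' i = {\<beta> \<in> S. \<beta> r\<^sub>0 = i}" for i
  have "(\<Sum>\<beta>\<in>S' i. a \<beta> * (\<Prod>r\<in>A. (z $ r) ^ \<beta> r)) = 0" (is "?c i z = 0")
    if "i \<le> n" for i and z :: "real ^ 'd"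
  proof -
    have "(\<Sum>i\<le>n. ?c i z * t ^ i) = 0" for t
    proof -
      define y where "y = (\<chi> r. if r = r\<^sub>0 then t else z $ r)"
      have "(\<Prod>r\<in>A. (y $ r) ^ \<beta> r) = (\<Prod>r\<in>A. (z $ r) ^ \<beta> r)" for \<beta> :: "'d \<Rightarrow> nat"
        using insert.hyps by (intro prod.cong) (auto simp: y_def)
      then have prod_y: "(\<Prod>r\<in>insert r\<^sub>0 A. (y $ r) ^ \<beta> r) = (\<Prod>r\<in>A. (z $ r) ^ \<beta> r) * t ^ \<beta> r\<^sub>0" for \<beta> :: "'d \<Rightarrow> nat"
        using insert.hyps by (simp add: y_def)
      have "(\<Sum>i\<le>n. ?c i z * t ^ i) =
          (\<Sum>i\<le>n. \<Sum>\<beta> | \<beta> \<in> S \<and> \<beta> r\<^sub>0 = i. a \<beta> * (\<Prod>r\<in>insert r\<^sub>0 A. (y $ r) ^ \<beta> r))"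
        unfolding S'_def sum_distrib_right by (intro sum.cong refl) (auto simp: prod_y)
      also have "\<dots> = (\<Sum>\<beta>\<in>S. a \<beta> * (\<Prod>r\<in>insert r\<^sub>0 A. (y $ r) ^ \<beta> r))"
        using n insert.prems(1) by (intro sum.group) auto
      finally show ?thesis using insert.prems(3) by simp
    qed
    then show ?thesis using polyfun_eq_0[of "\<lambda>i. ?c i z" n] that by blast
  qed
  moreover have "\<beta> = \<gamma>" if "\<beta> \<in> S' (\<alpha> r\<^sub>0)" "\<gamma> \<in> S' (\<alpha> r\<^sub>0)" "\<And>r. r \<in> A \<Longrightarrow> \<beta> r = \<gamma> r" for \<beta> \<gamma>
    using that by (intro insert.prems(2)) (auto simp: S'_def)
  ultimately show ?case
    using n[OF insert.prems(4)] insert.prems(1,4)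
    by (intro insert.IH[of "S' (\<alpha> r\<^sub>0)"]) (simp_all add: S'_def)
qed

lemma monomials_independent:
  fixes \<alpha> :: "nat \<Rightarrow> 'd::finite \<Rightarrow> nat"
  assumes "inj_on \<alpha> {..<m}" "\<And>z. (\<Sum>j<m. b j * monomial (\<alpha> j) z) = 0" "j < m"
  shows "b j = 0"
proof -
  define a where "a = b \<circ> the_inv_into {..<m} \<alpha>"
  have a: "a (\<alpha> i) = b i" if "i < m" for i
    using assms(1) that by (simp add: a_def the_inv_into_f_f)
  have "a (\<alpha> j) = 0"
  proof (rule monomials_independent_on[of UNIV "\<alpha> ` {..<m}"])
    show "(\<Sum>\<beta>\<in>\<alpha> ` {..<m}. a \<beta> * (\<Prod>r\<in>UNIV. (z $ r) ^ \<beta> r)) = 0" for z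
      using assms(2)[of z] by (simp add: sum.reindex[OF assms(1)] a monomial_def)
  qed (use assms(3) in auto)
  with a assms(3) show ?thesis by simp
qed

text \<open>On the line from the centre \<open>x\<close> to \<open>z\<close> the polynomial has
  infinitely many zeros near \<open>t = 0\<close>, so it also vanishes at \<open>t = 1\<close>. The
  summand 1 in the denominator of \<open>d\<close> covers \<open>z = x\<close>.\<close>

lemma poly_fun_zero_on_ball:
  fixes p :: "real ^ 'd::finite \<Rightarrow> real"
  assumes "poly_fun n p" "e > 0" "\<And>y. y \<in> ball x e \<Longrightarrow> p y = 0"
  shows "p z = 0"
proof -
  obtain q where q: "\<And>t. poly q t = p (x + t *\<^sub>R (z - x))"
    using poly_fun_line[OF assms(1)] by blast
  define d where "d = e / (norm (z - x) + 1)"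
  have d: "d > 0" using assms(2) by (simp add: d_def add_nonneg_pos)
  have "poly q t = 0" if "t \<in> {0<..<d}" for t
  proof -
    have "t * (norm (z - x) + 1) < e"
      using that by (simp add: d_def pos_less_divide_eq add_nonneg_pos)
    then have "t * norm (z - x) < e" using that by (simp add: distrib_left)
    then show ?thesis unfolding q using that by (intro assms(3)) (simp add: dist_norm)
  qed
  then have "{0<..<d} \<subseteq> {t. poly q t = 0}" by blast
  then have "q = 0" using infinite_Ioo[OF d] poly_roots_finite finite_subset by blast
  then show ?thesis using q[of 1] by simp
qed

text \<open>The space of lower-order terms at step \<open>k\<close>: the leading monomial, with
  exponent \<open>\<alpha> k\<close>, is excluded.\<close>

definition monomial_span :: "(nat \<Rightarrow> 'd::finite \<Rightarrow> nat) \<Rightarrow> nat \<Rightarrow> (real ^ 'd \<Rightarrow> real) set" where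
  "monomial_span \<alpha> k = {p. \<exists>b. p = (\<lambda>z. \<Sum>j<k. b j * monomial (\<alpha> j) z)}"

lemma monomial_span_add:
  assumes "p \<in> monomial_span \<alpha> k" "q \<in> monomial_span \<alpha> k"
  shows "(\<lambda>z. p z + q z) \<in> monomial_span \<alpha> k"
proof -
  obtain b b' where "p = (\<lambda>z. \<Sum>j<k. b j * monomial (\<alpha> j) z)" "q = (\<lambda>z. \<Sum>j<k. b' j * monomial (\<alpha> j) z)"
    using assms by (auto simp: monomial_span_def)
  then show ?thesis
    by (auto simp: monomial_span_def algebra_simps sum.distrib intro!: exI[of _ "\<lambda>j. b j + b' j"])
qed

lemma monomial_span_scale:
  assumes "p \<in> monomial_span \<alpha> k"
  shows "(\<lambda>z. c * p z) \<in> monomial_span \<alpha> k"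
proof -
  obtain b where "p = (\<lambda>z. \<Sum>j<k. b j * monomial (\<alpha> j) z)"
    using assms by (auto simp: monomial_span_def)
  then show ?thesis
    by (auto simp: monomial_span_def algebra_simps sum_distrib_left intro!: exI[of _ "\<lambda>j. c * b j"])
qed

lemma monomial_span_sum:
  assumes "\<And>i. i \<in> S \<Longrightarrow> p i \<in> monomial_span \<alpha> k"
  shows "(\<lambda>z. \<Sum>i\<in>S. p i z) \<in> monomial_span \<alpha> k"
proof (cases "finite S")
  case True
  then show ?thesis using assms
  proof (induction S rule: finite_induct)
    case empty
    show ?case by (auto simp: monomial_span_def intro!: exI[of _ "\<lambda>_. 0"])
  qed (auto intro: monomial_span_add)
next
  case False
  then show ?thesis by (auto simp: monomial_span_def intro!: exI[of _ "\<lambda>_. 0"])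
qed

lemma monomial_in_span: "l < k \<Longrightarrow> monomial (\<alpha> l) \<in> monomial_span \<alpha> k"
  by (auto simp: monomial_span_def if_distrib[of "\<lambda>x. x * _"] sum.delta
      intro!: exI[of _ "\<lambda>j. if j = l then 1 else 0"] cong: if_cong)

lemma monomial_span_mono:
  assumes "p \<in> monomial_span \<alpha> i" "i \<le> k"
  shows "p \<in> monomial_span \<alpha> k"
proof -
  obtain b where p: "p = (\<lambda>z. \<Sum>j<i. b j * monomial (\<alpha> j) z)"
    using assms by (auto simp: monomial_span_def)
  show ?thesis unfolding p
    using assms(2) by (intro monomial_span_sum monomial_span_scale monomial_in_span) auto
qed

lemma poly_space_eq_monomial_span:
  fixes \<alpha> :: "nat \<Rightarrow> 'd::finite \<Rightarrow> nat"
  assumes "bij_betw \<alpha> {..<N} (exponents T n)"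
  shows "poly_space T n = monomial_span \<alpha> N"
proof (intro Set.set_eqI iffI)
  fix p :: "real ^ 'd \<Rightarrow> real" assume "p \<in> poly_space T n"
  then obtain a where "p = (\<lambda>z. \<Sum>\<beta>\<in>exponents T n. a \<beta> * monomial \<beta> z)"
    by (auto simp: poly_space_def)
  then have "p = (\<lambda>z. \<Sum>j<N. a (\<alpha> j) * monomial (\<alpha> j) z)"
    by (simp add: sum.reindex_bij_betw[OF assms, symmetric])
  then show "p \<in> monomial_span \<alpha> N"
    unfolding monomial_span_def by (intro CollectI exI[of _ "\<lambda>j. a (\<alpha> j)"])
next
  fix p :: "real ^ 'd \<Rightarrow> real" assume "p \<in> monomial_span \<alpha> N"
  then obtain b where p: "p = (\<lambda>z. \<Sum>j<N. b j * monomial (\<alpha> j) z)"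
    by (auto simp: monomial_span_def)
  have inj: "inj_on \<alpha> {..<N}" using assms by (simp add: bij_betw_def)
  define a where "a = b \<circ> the_inv_into {..<N} \<alpha>"
  have "p = (\<lambda>z. \<Sum>j<N. a (\<alpha> j) * monomial (\<alpha> j) z)"
    unfolding p by (intro ext sum.cong refl) (simp add: a_def the_inv_into_f_f[OF inj])
  then have "p = (\<lambda>z. \<Sum>\<beta>\<in>exponents T n. a \<beta> * monomial \<beta> z)"
    using sum.reindex_bij_betw[OF assms, of "\<lambda>\<beta>. a \<beta> * monomial \<beta> z" for z] by simp
  then show "p \<in> poly_space T n"
    by (auto simp: poly_space_def)
qed

section \<open>Orthonormality of the V+A basis\<close>

lemma discrete_inner_commute: "discrete_inner M x g h = discrete_inner M x h g"
  by (simp add: discrete_inner_def mult.commute)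

lemma discrete_inner_diff_right:
  "discrete_inner M x g (\<lambda>z. h z - k z) = discrete_inner M x g h - discrete_inner M x g k"
  by (simp add: discrete_inner_def right_diff_distrib sum_subtractf diff_divide_distrib)

lemma discrete_inner_sum_right:
  "discrete_inner M x g (\<lambda>z. \<Sum>j\<in>S. c j * h j z) = (\<Sum>j\<in>S. c j * discrete_inner M x g (h j))"
  unfolding discrete_inner_def sum_distrib_left sum_divide_distrib
  by (subst sum.swap) (simp add: mult_ac)

lemma discrete_inner_divide_right:
  "discrete_inner M x g (\<lambda>z. h z / s) = discrete_inner M x g h / s"
  by (simp add: discrete_inner_def sum_divide_distrib[symmetric])

lemma discrete_inner_self_pos:
  assumes "i < M" "w (x i) \<noteq> 0"
  shows "discrete_inner M x w w > 0"
proof -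
  have "(\<Sum>i<M. w (x i) * w (x i)) > 0"
    using assms by (intro sum_pos2[of _ i]) (auto simp: zero_less_mult_iff)
  then show ?thesis using assms(1) by (simp add: discrete_inner_def)
qed

text \<open>Each basis function is triangular with respect to the ordering, which makes the next
  unnormalised one a nonzero polynomial; by \<open>nondeg\<close> it has a positive discrete norm,
  and Gram-Schmidt then gives orthonormality.\<close>

lemma va_basis_step:
  fixes x :: "nat \<Rightarrow> real ^ 'd::finite"
  assumes va: "va_basis T n M x \<alpha> \<phi>" and N: "N = space_dim TYPE('d) T n" and M: "M \<ge> 1"
    and nondeg: "\<forall>p\<in>poly_space T n. (\<forall>i<M. p (x i) = 0) \<longrightarrow> p = (\<lambda>_. 0)"
    and k: "k < N"
  shows "(\<exists>c p. c \<noteq> 0 \<and> p \<in> monomial_span \<alpha> k \<and> \<phi> k = (\<lambda>z. c * monomial (\<alpha> k) z + p z)) \<and>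
    (\<forall>j\<le>k. discrete_inner M x (\<phi> j) (\<phi> k) = (if j = k then 1 else 0))"
  using k
proof (induction k rule: less_induct)
  case (less k)
  let ?in = "discrete_inner M x"
  have bij: "bij_betw \<alpha> {..<N} (exponents T n)" and \<alpha>0: "\<alpha> 0 = (\<lambda>_. 0)" and \<phi>0: "\<phi> 0 = (\<lambda>_. 1)"
    using va N by (auto simp: va_basis_def)
  show ?case
  proof (cases "k = 0")
    case True
    have "(\<lambda>z. 0) \<in> monomial_span \<alpha> 0" by (simp add: monomial_span_def)
    then have "\<exists>c p. c \<noteq> 0 \<and> p \<in> monomial_span \<alpha> k \<and> \<phi> k = (\<lambda>z. c * monomial (\<alpha> k) z + p z)"
      using True by (intro exI[of _ 1] exI[of _ "\<lambda>_. 0"]) (auto simp: \<phi>0 \<alpha>0 monomial_def)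
    moreover have "?in (\<phi> 0) (\<phi> 0) = 1" using M by (simp add: \<phi>0 discrete_inner_def)
    ultimately show ?thesis using True by simp
  next
    case False
    then have "k \<in> {1..<space_dim TYPE('d) T n}" using less.prems N by simp
    with va obtain i r where i: "i < k" "\<alpha> k = raise_exponent r (\<alpha> i)"
      "\<And>j. j < i \<Longrightarrow> raise_exponent r (\<alpha> j) \<in> \<alpha> ` {..<k}"
      and step: "let v = (\<lambda>z. z $ r * \<phi> i z);
             w = (\<lambda>z. v z - (\<Sum>j<k. discrete_inner M x v (\<phi> j) * \<phi> j z))
         in \<phi> k = (\<lambda>z. w z / sqrt (discrete_inner M x w w))"
      unfolding va_basis_def by blast
    define v where "v = (\<lambda>z. z $ r * \<phi> i z)"
    define w where "w = (\<lambda>z. v z - (\<Sum>j<k. ?in v (\<phi> j) * \<phi> j z))"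
    define s where "s = sqrt (?in w w)"
    have \<phi>k: "\<phi> k = (\<lambda>z. w z / s)"
      using step by (simp add: Let_def v_def w_def s_def)
    have raise: "z $ r * monomial \<beta> z = monomial (raise_exponent r \<beta>) z" for \<beta> and z :: "real ^ 'd"
    proof -
      have "(\<Prod>q\<in>UNIV - {r}. (z $ q) ^ raise_exponent r \<beta> q) = (\<Prod>q\<in>UNIV - {r}. (z $ q) ^ \<beta> q)"
        by (intro prod.cong) (auto simp: raise_exponent_def)
      then show ?thesis
        by (simp add: monomial_def prod.remove[of UNIV r] raise_exponent_def)
    qed
    obtain c p where c: "c \<noteq> 0" "p \<in> monomial_span \<alpha> i" "\<phi> i = (\<lambda>z. c * monomial (\<alpha> i) z + p z)"
      using less.IH[OF i(1)] i(1) less.prems by auto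
    from c(2) obtain b where b: "p = (\<lambda>z. \<Sum>j<i. b j * monomial (\<alpha> j) z)"
      by (auto simp: monomial_span_def)
    \<comment> \<open>The suitability of the ordering enters here: after multiplication by the
      coordinate, all lower terms of \<open>\<phi> i\<close> have exponents listed before
      \<open>k\<close>.\<close>
    have "(\<lambda>z. \<Sum>j<i. b j * monomial (raise_exponent r (\<alpha> j)) z) \<in> monomial_span \<alpha> k"
    proof (intro monomial_span_sum monomial_span_scale)
      fix j assume "j \<in> {..<i}"
      then obtain l where "l < k" "raise_exponent r (\<alpha> j) = \<alpha> l" using i(3)[of j] by auto
      then show "monomial (raise_exponent r (\<alpha> j)) \<in> monomial_span \<alpha> k"
        by (simp add: monomial_in_span)
    qed
    then have zp: "(\<lambda>z. z $ r * p z) \<in> monomial_span \<alpha> k"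
      by (simp add: b sum_distrib_left mult.left_commute raise)
    have \<phi>_span: "\<phi> j \<in> monomial_span \<alpha> k" if j: "j < k" for j
    proof -
      obtain c p where "p \<in> monomial_span \<alpha> j" "\<phi> j = (\<lambda>z. c * monomial (\<alpha> j) z + p z)"
        using less.IH[OF j] j less.prems by auto
      then show ?thesis
        using j by (auto intro!: monomial_span_add monomial_span_scale monomial_in_span
            intro: monomial_span_mono)
    qed
    define q where "q = (\<lambda>z. z $ r * p z + (\<Sum>j<k. - ?in v (\<phi> j) * \<phi> j z))"
    have q: "q \<in> monomial_span \<alpha> k"
      unfolding q_def by (intro monomial_span_add monomial_span_sum monomial_span_scale zp \<phi>_span) auto
    have w: "w z = c * monomial (\<alpha> k) z + q z" for z
    proof -
      have "v z = c * monomial (\<alpha> k) z + z $ r * p z"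
        using raise[of z "\<alpha> i"] by (simp add: v_def c(3) i(2) algebra_simps)
      then show ?thesis by (simp add: w_def q_def sum_negf)
    qed
    \<comment> \<open>Otherwise \<open>w\<close> would be the zero polynomial, contradicting
      independence of the monomials, as its coefficient at \<open>\<alpha> k\<close> is
      \<open>c\<close>.\<close>
    have "\<exists>i<M. w (x i) \<noteq> 0"
    proof (rule ccontr)
      assume "\<not> ?thesis"
      moreover have "w \<in> poly_space T n"
      proof -
        have "(\<lambda>z. c * monomial (\<alpha> k) z + q z) \<in> monomial_span \<alpha> N"
          using less.prems q by (intro monomial_span_add monomial_span_scale monomial_in_span)
            (auto intro: monomial_span_mono)
        then show ?thesis
          using poly_space_eq_monomial_span[OF bij] by (simp add: w[abs_def])
      qed
      ultimately have w0: "w = (\<lambda>_. 0)" using nondeg by blast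
      obtain b where b: "q = (\<lambda>z. \<Sum>j<k. b j * monomial (\<alpha> j) z)"
        using q by (auto simp: monomial_span_def)
      have zero: "(\<Sum>j<Suc k. (b(k := c)) j * monomial (\<alpha> j) z) = 0" for z
      proof -
        have "(\<Sum>j<k. (b(k := c)) j * monomial (\<alpha> j) z) = q z"
          unfolding b by (intro sum.cong) auto
        then show ?thesis using w[of z] fun_cong[OF w0, of z] by simp
      qed
      have "inj_on \<alpha> {..<N}" using bij by (rule bij_betw_imp_inj_on)
      then have "inj_on \<alpha> {..<Suc k}" by (rule inj_on_subset) (use less.prems in auto)
      from monomials_independent[OF this zero lessI] have "(b(k := c)) k = 0" .
      then show False using c(1) by simp
    qed
    then have ww: "?in w w > 0" using discrete_inner_self_pos by blast
    then have s: "s > 0" by (simp add: s_def)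
    have "\<phi> k = (\<lambda>z. (c / s) * monomial (\<alpha> k) z + (1 / s) * q z)"
      by (simp add: \<phi>k w add_divide_distrib)
    moreover have "(\<lambda>z. (1 / s) * q z) \<in> monomial_span \<alpha> k"
      using q by (rule monomial_span_scale)
    moreover have "c / s \<noteq> 0" using c(1) s by simp
    ultimately have "\<exists>c p. c \<noteq> 0 \<and> p \<in> monomial_span \<alpha> k \<and> \<phi> k = (\<lambda>z. c * monomial (\<alpha> k) z + p z)"
      by blast
    moreover have "?in (\<phi> j) (\<phi> k) = (if j = k then 1 else 0)" if "j \<le> k" for j
    proof (cases "j = k")
      case True
      have "?in (\<phi> k) (\<phi> k) = ?in w w / s / s"
        unfolding \<phi>k discrete_inner_divide_right
        by (subst discrete_inner_commute) (simp add: discrete_inner_divide_right)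
      also have "\<dots> = 1" using ww by (simp add: s_def flip: power2_eq_square)
      finally show ?thesis using True by simp
    next
      case False
      with that have j: "j < k" by simp
      have orth: "?in (\<phi> j) (\<phi> l) = (if l = j then 1 else 0)" if "l < k" for l
      proof (cases "j \<le> l")
        case True
        then show ?thesis using less.IH[OF that] that less.prems by auto
      next
        case False
        then have "?in (\<phi> l) (\<phi> j) = 0" using less.IH[OF j] j less.prems by auto
        then show ?thesis using False by (simp add: discrete_inner_commute)
      qed
      have "?in (\<phi> j) w = ?in (\<phi> j) v - (\<Sum>l<k. ?in v (\<phi> l) * ?in (\<phi> j) (\<phi> l))"
        unfolding w_def discrete_inner_diff_right discrete_inner_sum_right ..
      also have "(\<Sum>l<k. ?in v (\<phi> l) * ?in (\<phi> j) (\<phi> l)) = (\<Sum>l<k. if l = j then ?in v (\<phi> l) else 0)"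
        by (intro sum.cong) (auto simp: orth)
      also have "\<dots> = ?in (\<phi> j) v" using j by (simp add: discrete_inner_commute)
      finally show ?thesis using False by (simp add: \<phi>k discrete_inner_divide_right)
    qed
    ultimately show ?thesis by blast
  qed
qed

text \<open>Back substitution: subtracting \<open>b k / c\<close> times \<open>\<phi> k\<close>
  removes the leading monomial and leaves a combination of lower ones.\<close>

lemma triangular_spans:
  assumes tri: "\<And>k. k < N \<Longrightarrow> \<exists>c p. c \<noteq> 0 \<and> p \<in> monomial_span \<alpha> k \<and> \<phi> k = (\<lambda>z. c * monomial (\<alpha> k) z + p z)"
    and "k \<le> N" "p \<in> monomial_span \<alpha> k"
  shows "\<exists>a. p = (\<lambda>z. \<Sum>j<k. a j * \<phi> j z)"
  using assms(2,3)
proof (induction k arbitrary: p)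
  case 0
  then show ?case by (simp add: monomial_span_def)
next
  case (Suc k)
  obtain b where b: "p = (\<lambda>z. \<Sum>j<Suc k. b j * monomial (\<alpha> j) z)"
    using Suc.prems by (auto simp: monomial_span_def)
  obtain c q where c: "c \<noteq> 0" "q \<in> monomial_span \<alpha> k" "\<phi> k = (\<lambda>z. c * monomial (\<alpha> k) z + q z)"
    using tri[OF Suc_le_lessD[OF Suc.prems(1)]] by blast
  have rest: "(\<lambda>z. (\<Sum>j<k. b j * monomial (\<alpha> j) z) + (- b k / c) * q z) \<in> monomial_span \<alpha> k"
    using c(2) by (intro monomial_span_add monomial_span_sum monomial_span_scale monomial_in_span) auto
  obtain a where a: "(\<lambda>z. (\<Sum>j<k. b j * monomial (\<alpha> j) z) + (- b k / c) * q z) = (\<lambda>z. \<Sum>j<k. a j * \<phi> j z)"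
    using Suc.IH[OF Suc_leD[OF Suc.prems(1)] rest] by (elim exE)
  show ?case
  proof (intro exI[of _ "a(k := b k / c)"] ext)
    fix z
    have "(\<Sum>j<k. (a(k := b k / c)) j * \<phi> j z) = (\<Sum>j<k. a j * \<phi> j z)"
      by (intro sum.cong) auto
    then show "p z = (\<Sum>j<Suc k. (a(k := b k / c)) j * \<phi> j z)"
      using fun_cong[OF a, of z] c(1) by (simp add: b c(3) distrib_left)
  qed
qed

text \<open>The squared error along \<open>Lf + t * g\<close> changes by
  \<open>t^2 * G - 2 * t * S\<close>. Its minimiser \<open>t = S / G\<close> would lower the error
  by \<open>S^2 / G\<close>, so \<open>S\<close> must vanish.\<close>

lemma least_squares_normal_equation:
  fixes x :: "nat \<Rightarrow> real ^ 'd::finite"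
  assumes ls: "least_squares_approx T n M x f Lf"
    and g: "\<And>t. (\<lambda>z. Lf z + t * g z) \<in> poly_space T n" "(\<Sum>i<M. (g (x i))\<^sup>2) > 0"
  shows "(\<Sum>i<M. (f (x i) - Lf (x i)) * g (x i)) = 0"
proof -
  define S where "S = (\<Sum>i<M. (f (x i) - Lf (x i)) * g (x i))"
  define G where "G = (\<Sum>i<M. (g (x i))\<^sup>2)"
  define t where "t = S / G"
  have "(\<Sum>i<M. \<bar>f (x i) - Lf (x i)\<bar>\<^sup>2) \<le> (\<Sum>i<M. \<bar>f (x i) - (Lf (x i) + t * g (x i))\<bar>\<^sup>2)"
    using ls g(1)[of t] unfolding least_squares_approx_def is_arg_min_linorder by blast
  also have "\<dots> = (\<Sum>i<M. \<bar>f (x i) - Lf (x i)\<bar>\<^sup>2 - 2 * t * ((f (x i) - Lf (x i)) * g (x i)) + t\<^sup>2 * (g (x i))\<^sup>2)"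
    by (intro sum.cong refl) (simp add: power2_eq_square algebra_simps)
  also have "\<dots> = (\<Sum>i<M. \<bar>f (x i) - Lf (x i)\<bar>\<^sup>2) - 2 * t * S + t\<^sup>2 * G"
    unfolding S_def G_def by (simp only: sum.distrib sum_subtractf sum_distrib_left)
  finally have "2 * t * S \<le> t\<^sup>2 * G" by simp
  moreover have G: "G > 0" using g(2) by (simp add: G_def)
  then have "t\<^sup>2 * G = S\<^sup>2 / G" "2 * t * S = 2 * (S\<^sup>2 / G)"
    by (simp_all add: t_def power2_eq_square)
  ultimately have "S\<^sup>2 / G \<le> 0" by simp
  then have "S = 0" using G by (simp add: divide_le_0_iff)
  then show ?thesis by (simp add: S_def)
qed

section \<open>Least squares on the samples\<close>

lemma gram_entry:
  assumes "k < M" "i < M"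
  shows "(Q_matrix M N x \<phi> * transpose_mat (Q_matrix M N x \<phi>)) $$ (k, i) = (\<Sum>j<N. \<phi> j (x k) * \<phi> j (x i))"
  using assms by (simp add: Q_matrix_def scalar_prod_def atLeast0LessThan)

lemma row_sum_norm_gram:
  "row_sum_norm (Q_matrix M N x \<phi> * transpose_mat (Q_matrix M N x \<phi>)) =
    Max ((\<lambda>k. \<Sum>i<M. \<bar>\<Sum>j<N. \<phi> j (x k) * \<phi> j (x i)\<bar>) ` {..<M})"
proof -
  have "dim_row (Q_matrix M N x \<phi> * transpose_mat (Q_matrix M N x \<phi>)) = M"
    "dim_col (Q_matrix M N x \<phi> * transpose_mat (Q_matrix M N x \<phi>)) = M"
    by (simp_all add: Q_matrix_def)
  then show ?thesis
    unfolding row_sum_norm_def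
    by (intro arg_cong[of _ _ Max] image_cong refl)
      (auto intro!: sum.cong simp: gram_entry simp del: index_mult_mat)
qed

text \<open>As \<open>Q Q\<^sup>* / M\<close> is an orthogonal projection, its diagonal entries are at most 1 and the squares
  of each row sum to the diagonal entry; Cauchy--Schwarz then bounds the row sums.\<close>

lemma row_sum_norm_gram_le:
  assumes M: "M \<ge> 1"
    and orth: "\<And>j l. j < N \<Longrightarrow> l < N \<Longrightarrow> discrete_inner M x (\<phi> j) (\<phi> l) = (if j = l then 1 else 0)"
  shows "row_sum_norm (Q_matrix M N x \<phi> * transpose_mat (Q_matrix M N x \<phi>)) \<le> real M * sqrt (real M)"
proof -
  define G where "G k i = (\<Sum>j<N. \<phi> j (x k) * \<phi> j (x i))" for k i
  have "(\<Sum>i<M. \<bar>G k i\<bar>) \<le> real M * sqrt (real M)" if k: "k < M" for k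
  proof -
    have M0: "real M > 0" using M by simp
    have orth': "(\<Sum>i<M. \<phi> j (x i) * \<phi> l (x i)) = (if j = l then real M else 0)" if "j < N" "l < N" for j l
      using orth[OF that] M0 by (auto simp: discrete_inner_def divide_eq_eq split: if_splits)
    \<comment> \<open>The computation up to \<open>sq\<close> is a diagonal entry of the identity
      \<open>G * G = M * G\<close>, which follows from orthonormality.\<close>
    have "(\<Sum>i<M. (G k i)\<^sup>2) = (\<Sum>i<M. \<Sum>j<N. \<Sum>l<N. \<phi> j (x k) * \<phi> l (x k) * (\<phi> j (x i) * \<phi> l (x i)))"
      by (simp add: G_def power2_eq_square sum_product mult_ac)
    also have "\<dots> = (\<Sum>j<N. \<Sum>l<N. \<phi> j (x k) * \<phi> l (x k) * (\<Sum>i<M. \<phi> j (x i) * \<phi> l (x i)))"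
      unfolding sum_distrib_left by (simp only: sum.swap[where A = "{..<M}"])
    also have "\<dots> = (\<Sum>j<N. \<Sum>l<N. if l = j then \<phi> j (x k) * \<phi> j (x k) * real M else 0)"
      by (intro sum.cong refl) (auto simp: orth')
    also have "\<dots> = real M * G k k"
      by (simp add: G_def sum_distrib_left mult_ac)
    finally have sq: "(\<Sum>i<M. (G k i)\<^sup>2) = real M * G k k" .
    have "(G k k)\<^sup>2 \<le> (\<Sum>i<M. (G k i)\<^sup>2)"
      using k by (intro member_le_sum) auto
    then have "G k k * G k k \<le> real M * G k k" unfolding sq by (simp add: power2_eq_square)
    moreover have "G k k \<ge> 0" by (simp add: G_def sum_nonneg)
    ultimately have "G k k \<le> real M"
      by (cases "G k k = 0") auto
    then have row: "(\<Sum>i<M. (G k i)\<^sup>2) \<le> real M * real M"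
      using M0 by (simp add: sq)
    have "(\<Sum>i<M. \<bar>G k i\<bar>)\<^sup>2 \<le> (\<Sum>i<M. (G k i)\<^sup>2) * real M"
      using sum_squared_le_sum_of_squares[of "\<lambda>i. \<bar>G k i\<bar>" "{..<M}"] by simp
    also have "\<dots> \<le> (real M * real M) * real M"
      by (rule mult_right_mono[OF row]) simp
    also have "\<dots> = (real M * sqrt (real M))\<^sup>2"
      by (simp add: power_mult_distrib power2_eq_square)
    finally have "(\<Sum>i<M. \<bar>G k i\<bar>)\<^sup>2 \<le> (real M * sqrt (real M))\<^sup>2" .
    then show ?thesis by (rule power2_le_imp_le) simp
  qed
  then show ?thesis
    unfolding row_sum_norm_gram using M by (intro Max.boundedI) (auto simp: G_def lessThan_empty_iff)
qed

text \<open>The interface to the least-squares argument, which sees neither the recursion nor the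
  ordering.\<close>

lemma va_basis_orthonormal_spanning:
  fixes x :: "nat \<Rightarrow> real ^ 'd::finite"
  assumes va: "va_basis T n M x \<alpha> \<phi>" and N: "N = space_dim TYPE('d) T n" and M: "M \<ge> 1"
    and nondeg: "\<forall>p\<in>poly_space T n. (\<forall>i<M. p (x i) = 0) \<longrightarrow> p = (\<lambda>_. 0)"
  shows va_basis_orthonormal: "j < N \<Longrightarrow> l < N \<Longrightarrow>
      discrete_inner M x (\<phi> j) (\<phi> l) = (if j = l then 1 else 0)"
    and va_basis_in_space: "j < N \<Longrightarrow> q \<in> poly_space T n \<Longrightarrow> (\<lambda>z. q z + t * \<phi> j z) \<in> poly_space T n"
    and va_basis_spans: "q \<in> poly_space T n \<Longrightarrow> \<exists>a. q = (\<lambda>z. \<Sum>j<N. a j * \<phi> j z)"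
proof -
  note step = va_basis_step[OF va N M nondeg]
  have bij: "bij_betw \<alpha> {..<N} (exponents T n)" using va N by (simp add: va_basis_def)
  note space = poly_space_eq_monomial_span[OF bij]
  have tri: "\<exists>c p. c \<noteq> 0 \<and> p \<in> monomial_span \<alpha> k \<and> \<phi> k = (\<lambda>z. c * monomial (\<alpha> k) z + p z)" if "k < N" for k
    using conjunct1[OF step[OF that]] .
  have orth: "discrete_inner M x (\<phi> i) (\<phi> k) = (if i = k then 1 else 0)" if "i \<le> k" "k < N" for i k
    using mp[OF spec[OF conjunct2[OF step[OF that(2)]]] that(1)] .
  show "discrete_inner M x (\<phi> j) (\<phi> l) = (if j = l then 1 else 0)" if jl: "j < N" "l < N"
  proof (cases "j \<le> l")
    case True
    then show ?thesis using jl(2) by (rule orth)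
  next
    case False
    then have "discrete_inner M x (\<phi> l) (\<phi> j) = (if l = j then 1 else 0)"
      using jl(1) by (intro orth) simp
    then show ?thesis using discrete_inner_commute[of M x "\<phi> j" "\<phi> l"] by presburger
  qed
  show "(\<lambda>z. q z + t * \<phi> j z) \<in> poly_space T n" if j: "j < N" and q: "q \<in> poly_space T n"
  proof -
    obtain c p where p: "p \<in> monomial_span \<alpha> j" "\<phi> j = (\<lambda>z. c * monomial (\<alpha> j) z + p z)"
      using tri[OF j] by blast
    have "p \<in> monomial_span \<alpha> N" using p(1) less_imp_le[OF j] by (rule monomial_span_mono)
    then have "\<phi> j \<in> monomial_span \<alpha> N"
      unfolding p(2) by (rule monomial_span_add[OF monomial_span_scale[OF monomial_in_span[OF j]]])
    then show ?thesis
      unfolding space by (rule monomial_span_add[OF q[unfolded space] monomial_span_scale])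
  qed
  show "\<exists>a. q = (\<lambda>z. \<Sum>j<N. a j * \<phi> j z)" if "q \<in> poly_space T n"
    by (rule triangular_spans[OF _ order.refl that[unfolded space]]) (rule tri)
qed

lemma poly_space_diff:
  assumes "p \<in> poly_space T n" "q \<in> poly_space T n"
  shows "(\<lambda>z. p z - q z) \<in> poly_space T n"
proof -
  obtain a b where "p = (\<lambda>z. \<Sum>\<alpha>\<in>exponents T n. a \<alpha> * monomial \<alpha> z)"
    "q = (\<lambda>z. \<Sum>\<alpha>\<in>exponents T n. b \<alpha> * monomial \<alpha> z)"
    using assms by (auto simp: poly_space_def)
  then show ?thesis
    by (auto simp: poly_space_def left_diff_distrib sum_subtractf intro!: exI[of _ "\<lambda>\<alpha>. a \<alpha> - b \<alpha>"])
qed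

lemma least_squares_sample_error:
  fixes x :: "nat \<Rightarrow> real ^ 'd::finite"
  assumes M: "M \<ge> 1"
    and orth: "\<And>j l. j < N \<Longrightarrow> l < N \<Longrightarrow> discrete_inner M x (\<phi> j) (\<phi> l) = (if j = l then 1 else 0)"
    and space: "\<And>j q t. j < N \<Longrightarrow> q \<in> poly_space T n \<Longrightarrow> (\<lambda>z. q z + t * \<phi> j z) \<in> poly_space T n"
    and spans: "\<And>q. q \<in> poly_space T n \<Longrightarrow> \<exists>a. q = (\<lambda>z. \<Sum>j<N. a j * \<phi> j z)"
    and ls: "least_squares_approx T n M x f Lf" and p: "p \<in> poly_space T n"
    and err: "\<And>i. i < M \<Longrightarrow> \<bar>f (x i) - p (x i)\<bar> \<le> E" and k: "k < M"
  shows "\<bar>Lf (x k) - p (x k)\<bar> \<le>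
    row_sum_norm (Q_matrix M N x \<phi> * transpose_mat (Q_matrix M N x \<phi>)) / real M * E"
proof -
  have M0: "real M > 0" using M by simp
  have Lf: "Lf \<in> poly_space T n"
    using ls by (simp add: least_squares_approx_def is_arg_min_def)
  obtain a where a: "(\<lambda>z. Lf z - p z) = (\<lambda>z. \<Sum>j<N. a j * \<phi> j z)"
    using spans[OF poly_space_diff[OF Lf p]] by blast
  have aj: "a j = (\<Sum>i<M. \<phi> j (x i) * (f (x i) - p (x i))) / real M" if j: "j < N" for j
  proof -
    have "(\<Sum>i<M. (\<phi> j (x i))\<^sup>2) = real M"
      using orth[OF j j] M0 by (simp add: discrete_inner_def power2_eq_square)
    \<comment> \<open>The residual is orthogonal to \<open>\<phi> j\<close>, so
      \<open>Lf - p\<close> and \<open>f - p\<close> have the same coefficient there.\<close>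
    then have "(\<Sum>i<M. (f (x i) - Lf (x i)) * \<phi> j (x i)) = 0"
      using M0 by (intro least_squares_normal_equation[OF ls] space j Lf) simp
    then have "(\<Sum>i<M. \<phi> j (x i) * (f (x i) - p (x i))) = (\<Sum>i<M. \<phi> j (x i) * (Lf (x i) - p (x i)))"
      unfolding left_diff_distrib right_diff_distrib sum_subtractf by (simp add: mult.commute)
    also have "\<dots> / real M = discrete_inner M x (\<phi> j) (\<lambda>z. \<Sum>l<N. a l * \<phi> l z)"
      by (simp add: discrete_inner_def flip: a)
    also have "\<dots> = (\<Sum>l<N. if l = j then a l else 0)"
      unfolding discrete_inner_sum_right by (intro sum.cong refl) (simp add: orth j)
    also have "\<dots> = a j" using j by simp
    finally show ?thesis by simp
  qed
  define R where "R = row_sum_norm (Q_matrix M N x \<phi> * transpose_mat (Q_matrix M N x \<phi>))"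
  have E: "E \<ge> 0" using err[OF k] by simp
  have "Lf (x k) - p (x k) = (\<Sum>j<N. a j * \<phi> j (x k))"
    using fun_cong[OF a, of "x k"] .
  also have "\<dots> = (\<Sum>j<N. \<Sum>i<M. \<phi> j (x k) * \<phi> j (x i) * (f (x i) - p (x i)) / real M)"
    by (intro sum.cong refl) (simp add: aj sum_divide_distrib sum_distrib_left sum_distrib_right mult_ac)
  also have "\<dots> = (\<Sum>i<M. (\<Sum>j<N. \<phi> j (x k) * \<phi> j (x i)) * (f (x i) - p (x i))) / real M"
    by (subst sum.swap) (simp add: sum_distrib_right sum_divide_distrib)
  finally have "\<bar>Lf (x k) - p (x k)\<bar> =
      \<bar>\<Sum>i<M. (\<Sum>j<N. \<phi> j (x k) * \<phi> j (x i)) * (f (x i) - p (x i))\<bar> / real M"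
    using M0 by simp
  also have "\<dots> \<le> (\<Sum>i<M. \<bar>\<Sum>j<N. \<phi> j (x k) * \<phi> j (x i)\<bar> * E) / real M"
    using M0 err by (intro divide_right_mono order.trans[OF sum_abs] sum_mono)
      (auto simp: abs_mult intro!: mult_left_mono)
  also have "\<dots> = (\<Sum>i<M. \<bar>\<Sum>j<N. \<phi> j (x k) * \<phi> j (x i)\<bar>) * E / real M"
    by (simp add: sum_distrib_right)
  also have "\<dots> \<le> R * E / real M"
    unfolding R_def row_sum_norm_gram using k E M0
    by (intro divide_right_mono mult_right_mono Max_ge) auto
  finally show ?thesis by (simp add: R_def)
qed

section \<open>Equispaced meshes and the error bounds\<close>

text \<open>The grid point nearest to a boundary point may fall outside \<open>K\<close>. So
  \<open>z\<close> is first moved towards the centre \<open>x\<close> of an inscribed ball, by a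
  fraction \<open>t\<close> proportional to the grid spacing; the resulting \<open>z'\<close> has
  enough room in \<open>K\<close> to be rounded. The constant \<open>A\<close> depends on
  \<open>K\<close> alone, not on the grid.\<close>

lemma convex_body_nearby_grid_point:
  fixes K :: "(real ^ 'd::finite) set"
  assumes "convex_body K"
  obtains A where "A > 0"
    "\<And>a l m z. \<lbrakk>l > 0; m \<ge> 1; K \<subseteq> cbox a (\<chi> r. a $ r + l); A * (l / real m) \<le> 1; z \<in> K\<rbrakk> \<Longrightarrow>
      \<exists>k. (\<forall>r. k r \<le> m) \<and> (\<chi> r. a $ r + l * real (k r) / real m) \<in> K \<and>
        infnorm ((\<chi> r. a $ r + l * real (k r) / real m) - z) \<le> A * (l / real m)"
proof -
  obtain x e where x: "e > 0" "cball x e \<subseteq> K" using convex_body_contains_cball assms by blast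
  have K: "convex K" "bounded K" using assms by (auto simp: convex_body_def compact_imp_bounded)
  have xK: "x \<in> K" using x by auto
  obtain D where D: "\<And>y. y \<in> K \<Longrightarrow> norm (x - y) \<le> D"
    using K(2) bounded_any_center[of K x] by (auto simp: dist_norm)
  have D0: "D \<ge> 0" using D[OF xK] by simp
  define d where "d = real CARD('d)"
  have d: "d > 0" by (simp add: d_def)
  \<comment> \<open>The first summand makes \<open>t\<close> at most 1 whenever
    \<open>A * h <= 1\<close>; the second bounds the rounding error \<open>d * h\<close> plus the
    shift \<open>t * D\<close>.\<close>
  define A where "A = d / e + (d + d / e * D)"
  have A: "A > 0" "d / e \<le> A" "d + d / e * D \<le> A"
    using d x(1) D0 by (auto simp: A_def add_pos_nonneg)
  show thesis
  proof (rule that[of A])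
    fix a l m z
    assume l: "(l :: real) > 0" and m: "(m :: nat) \<ge> 1" and cube: "K \<subseteq> cbox a (\<chi> r. a $ r + l)"
      and le1: "A * (l / real m) \<le> 1" and z: "z \<in> K"
    define h where "h = l / real m"
    have h: "h > 0" using l m by (simp add: h_def)
    define t where "t = d / e * h"
    have "t \<le> A * h" unfolding t_def using A(2) h by (intro mult_right_mono) auto
    then have "t \<le> 1" using le1[folded h_def] by (rule order.trans)
    moreover have "t > 0" using h d x(1) by (simp add: t_def)
    ultimately have t: "t > 0" "t \<le> 1" by simp_all
    define z' where "z' = (1 - t) *\<^sub>R z + t *\<^sub>R x"
    have z': "z' \<in> K" unfolding z'_def using t by (intro convexD_alt[OF K(1) z xK]) auto
    \<comment> \<open>Rounding down stays among the indices 0 to \<open>m\<close> because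
      \<open>z'\<close> lies in the cube.\<close>
    define k where "k r = nat \<lfloor>(z' $ r - a $ r) / h\<rfloor>" for r
    define y where "y = (\<chi> r. a $ r + l * real (k r) / real m)"
    have box: "0 \<le> z' $ r - a $ r" "z' $ r - a $ r \<le> l" for r
      using subsetD[OF cube z'] by (auto simp: mem_box_cart algebra_simps)
    have km: "k r \<le> m" for r
    proof -
      have "(z' $ r - a $ r) / h \<le> l / h" using box(2) h by (intro divide_right_mono) auto
      also have "l / h = real m" using l m by (simp add: h_def)
      finally show ?thesis unfolding k_def by linarith
    qed
    have y_z': "\<bar>(y - z') $ r\<bar> \<le> h" for r
    proof -
      have "0 \<le> (z' $ r - a $ r) / h" using box(1) h by simp
      then have "real (k r) = of_int \<lfloor>(z' $ r - a $ r) / h\<rfloor>" by (simp add: k_def)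
      then have "real (k r) \<le> (z' $ r - a $ r) / h" "(z' $ r - a $ r) / h \<le> real (k r) + 1"
        by linarith+
      then have "h * real (k r) \<le> z' $ r - a $ r" "z' $ r - a $ r \<le> h * real (k r) + h"
        using h by (auto simp: field_simps)
      then show ?thesis by (simp add: y_def h_def)
    qed
    have v: "norm (y - z') \<le> d * h"
    proof -
      have "norm (y - z') \<le> (\<Sum>r\<in>UNIV. \<bar>(y - z') $ r\<bar>)" by (rule norm_le_l1_cart)
      also have "\<dots> \<le> (\<Sum>r\<in>(UNIV :: 'd set). h)" by (intro sum_mono y_z')
      finally show ?thesis by (simp add: d_def)
    qed
    \<comment> \<open>The fraction \<open>t = d / e * h\<close> was chosen for this: enlarged by 1 /
      \<open>t\<close>, the rounding offset fits into the ball around \<open>x\<close>, and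
      \<open>y\<close> is a convex combination of \<open>z\<close> and a point of that ball.\<close>
    have "norm (y - z') \<le> t * e" using v x(1) by (simp add: t_def)
    then have "norm ((1 / t) *\<^sub>R (y - z')) \<le> e"
      using t(1) by (simp add: divide_le_eq mult.commute del: scaleR_right_diff_distrib)
    then have "x + (1 / t) *\<^sub>R (y - z') \<in> K"
      by (intro subsetD[OF x(2)]) (simp add: dist_norm)
    then have "(1 - t) *\<^sub>R z + t *\<^sub>R (x + (1 / t) *\<^sub>R (y - z')) \<in> K"
      using t by (intro convexD_alt[OF K(1) z]) auto
    also have "(1 - t) *\<^sub>R z + t *\<^sub>R (x + (1 / t) *\<^sub>R (y - z')) = y"
      using t(1) by (simp add: z'_def scaleR_add_right)
    finally have yK: "y \<in> K" .
    have "infnorm (y - z) \<le> norm ((y - z') + t *\<^sub>R (x - z))"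
      using infnorm_le_norm[of "y - z"] by (simp add: z'_def algebra_simps)
    also have "\<dots> \<le> norm (y - z') + norm (t *\<^sub>R (x - z))" by (rule norm_triangle_ineq)
    also have "\<dots> \<le> d * h + t * D"
      using v D[OF z] t(1) by (intro add_mono) (auto intro: mult_left_mono)
    also have "\<dots> = (d + d / e * D) * h" by (simp add: t_def algebra_simps)
    also have "\<dots> \<le> A * h" using A(3) h by (intro mult_right_mono) auto
    finally show "\<exists>k. (\<forall>r. k r \<le> m) \<and> (\<chi> r. a $ r + l * real (k r) / real m) \<in> K \<and>
        infnorm ((\<chi> r. a $ r + l * real (k r) / real m) - z) \<le> A * (l / real m)"
      using km yK by (auto simp: y_def h_def intro!: exI[of _ k])
  qed (rule A(1))
qed

text \<open>Also counts the index functions of a grid with \<open>m + 1\<close> points per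
  edge.\<close>

lemma card_exponents_Maximum:
  "card (exponents Maximum m :: ('d::finite \<Rightarrow> nat) set) = Suc m ^ CARD('d)"
proof -
  have eq: "(exponents Maximum m :: ('d \<Rightarrow> nat) set) = UNIV \<rightarrow>\<^sub>E {..m}"
    unfolding PiE_UNIV_domain Pi_def by simp
  show ?thesis unfolding eq by (subst card_PiE) (simp_all only: finite card_atMost prod_constant)
qed

text \<open>From \<open>(n + d) choose d >= ((n + d) / d)^d\<close>. A spacing of order 1 / n^2
  takes about n^(2 d) grid points, the square of n^d, and so O(N^2).\<close>

lemma power_le_space_dim:
  "real n ^ CARD('d) \<le> real CARD('d) ^ CARD('d) * real (space_dim TYPE('d::finite) T n)"
proof -
  define d where "d = CARD('d)"
  have d: "d > 0" by (simp add: d_def)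
  have "(real n / real d) ^ d \<le> (real (n + d) / real d) ^ d"
    by (intro power_mono divide_right_mono) auto
  also have "\<dots> \<le> real ((n + d) choose d)"
    using binomial_ge_n_over_k_pow_k[of d "n + d", where 'a = real] by simp
  also have "\<dots> = real (space_dim TYPE('d) Total n)"
    by (simp add: space_dim_Total d_def[symmetric] binomial_symmetric[of d "n + d"])
  also have "\<dots> \<le> real (space_dim TYPE('d) T n)"
  proof (cases T)
    case Maximum
    have "(exponents Total n :: ('d \<Rightarrow> nat) set) \<subseteq> exponents Maximum n"
    proof
      fix \<alpha> :: "'d \<Rightarrow> nat" assume "\<alpha> \<in> exponents Total n"
      then have "\<alpha> r \<le> n" for r using member_le_sum[of r UNIV \<alpha>] by simp
      then show "\<alpha> \<in> exponents Maximum n" by simp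
    qed
    then show ?thesis
      unfolding Maximum space_dim_def by (simp del: exponents.simps add: card_mono finite_exponents)
  qed simp
  finally show ?thesis using d by (simp add: d_def[symmetric] power_divide field_simps)
qed

lemma markov_const_pos:
  fixes \<K> :: "(real ^ 'd::finite) set set"
  assumes "finite \<K>" "\<K> \<noteq> {}" "\<And>K. K \<in> \<K> \<Longrightarrow> convex_body K"
  shows "markov_const T \<K> > 0"
proof -
  obtain K where K: "K \<in> \<K>" using assms(2) by blast
  have "total_degree_bound TYPE('d) T 1 \<ge> 1" by (cases T) (auto simp: Suc_le_eq)
  then have "0 < 4 / min_width K * (real (total_degree_bound TYPE('d) T 1))\<^sup>2"
    using min_width_pos[OF assms(3)[OF K]] by simp
  also have "\<dots> \<le> markov_const T \<K>" using markov_const_ge[OF assms(1) K, of 1 T] by simp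
  finally show ?thesis .
qed

text \<open>Shows that the density demanded by the mesh condition is compatible with
  \<open>M = O(N^2)\<close>; the constant may depend on the domain and on \<open>c\<close>, but not
  on \<open>n\<close>.\<close>

lemma exists_equispaced_mesh:
  fixes \<K> :: "(real ^ 'd::finite) set set"
  assumes c: "c > 0" and \<K>: "finite \<K>" "\<K> \<noteq> {}" "\<And>K. K \<in> \<K> \<Longrightarrow> convex_body K"
  shows "\<exists>C. \<forall>n\<ge>1. \<exists>X. equispaced_discretization (\<Union>\<K>) X \<and> mesh_condition T n c \<K> X \<and>
    finite X \<and> real (card X) \<le> C * (real (space_dim TYPE('d) T n))\<^sup>2"
proof -
  define W where "W = markov_const T \<K>"
  have W: "W > 0" unfolding W_def using \<K> by (rule markov_const_pos)
  have "bounded (\<Union>\<K>)" using \<K> by (auto simp: convex_body_def compact_imp_bounded)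
  then obtain b where b: "b > 0" "\<And>z. z \<in> \<Union>\<K> \<Longrightarrow> norm z \<le> b"
    unfolding bounded_pos by blast
  \<comment> \<open>One cube serves every \<open>n\<close>; only the number \<open>m\<close> of grid
    steps grows.\<close>
  define a :: "real ^ 'd" where "a = (\<chi> r. - b)"
  define l where "l = 2 * b"
  have l: "l > 0" using b by (simp add: l_def)
  have "z \<in> cbox a (\<chi> r. a $ r + l)" if "z \<in> \<Union>\<K>" for z
  proof -
    have "\<bar>z $ r\<bar> \<le> b" for r using order.trans[OF component_le_norm_cart b(2)[OF that]] .
    then have "- b \<le> z $ r \<and> z $ r \<le> b" for r by (simp add: abs_le_iff minus_le_iff)
    then show ?thesis by (simp add: mem_box_cart a_def l_def)
  qed
  then have cube: "\<Union>\<K> \<subseteq> cbox a (\<chi> r. a $ r + l)" by blast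
  define near_grid where "near_grid K A \<longleftrightarrow> (\<forall>m z. m \<ge> 1 \<longrightarrow> A * (l / real m) \<le> 1 \<longrightarrow> z \<in> K \<longrightarrow>
      (\<exists>k. (\<forall>r. k r \<le> m) \<and> (\<chi> r. a $ r + l * real (k r) / real m) \<in> K \<and>
        infnorm ((\<chi> r. a $ r + l * real (k r) / real m) - z) \<le> A * (l / real m)))" for K A
  have "\<forall>K\<in>\<K>. \<exists>A. A > 0 \<and> near_grid K A"
  proof
    fix K assume K: "K \<in> \<K>"
    then have box: "K \<subseteq> cbox a (\<chi> r. a $ r + l)" using cube by blast
    show "\<exists>A. A > 0 \<and> near_grid K A"
    proof (rule convex_body_nearby_grid_point[OF \<K>(3)[OF K]])
      fix A :: real
      assume pos: "A > 0" and A: "\<And>a l m z. \<lbrakk>l > 0; m \<ge> 1; K \<subseteq> cbox a (\<chi> r. a $ r + l); A * (l / real m) \<le> 1; z \<in> K\<rbrakk> \<Longrightarrow>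
        \<exists>k. (\<forall>r. k r \<le> m) \<and> (\<chi> r. a $ r + l * real (k r) / real m) \<in> K \<and>
          infnorm ((\<chi> r. a $ r + l * real (k r) / real m) - z) \<le> A * (l / real m)"
      have "near_grid K A"
        unfolding near_grid_def by (intro allI impI A l box)
      with pos show ?thesis by blast
    qed
  qed
  from bchoice[OF this] obtain A' where A': "\<And>K. K \<in> \<K> \<Longrightarrow> A' K > 0" "\<And>K. K \<in> \<K> \<Longrightarrow> near_grid K (A' K)"
    by blast
  \<comment> \<open>The sum is a common upper bound for the constants of the finitely many
    bodies.\<close>
  define A where "A = sum A' \<K>"
  have A_ge: "A' K \<le> A" if "K \<in> \<K>" for K
    unfolding A_def using that A'(1) \<K>(1) by (intro member_le_sum) (auto intro: less_imp_le)
  have A: "A > 0" unfolding A_def using \<K> A'(1) by (intro sum_pos) auto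
  \<comment> \<open>With \<open>m >= B * n^2\<close> the 1 in the last factor gives
    \<open>A * (l / m) <= 1\<close>, as the grid lemma demands, and \<open>W / c\<close> gives the
    distance of the mesh condition.\<close>
  define B where "B = A * l * (1 + W / c)"
  have B: "B > 0" using A l W c by (simp add: B_def add_pos_pos)
  define d where "d = CARD('d)"
  have "\<exists>X. equispaced_discretization (\<Union>\<K>) X \<and> mesh_condition T n c \<K> X \<and>
    finite X \<and> real (card X) \<le> (B + 2) ^ d * (real d ^ d)\<^sup>2 * (real (space_dim TYPE('d) T n))\<^sup>2"
    if n: "n \<ge> 1" for n
  proof -
    have n2: "(real n)\<^sup>2 \<ge> 1" using n by simp
    define m where "m = nat \<lceil>B * (real n)\<^sup>2\<rceil>"
    have Bn: "B * (real n)\<^sup>2 > 0" using B n by simp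
    then have m: "real m \<ge> B * (real n)\<^sup>2" "real m \<le> B * (real n)\<^sup>2 + 1" "m \<ge> 1"
      unfolding m_def by linarith+
    have "A * (l / real m) \<le> A * l / (B * (real n)\<^sup>2)"
      using m(1) Bn A l by (auto intro!: divide_left_mono mult_pos_pos)
    also have "\<dots> = 1 / ((1 + W / c) * (real n)\<^sup>2)"
      using A l by (simp add: B_def)
    finally have h: "A * (l / real m) \<le> 1 / ((1 + W / c) * (real n)\<^sup>2)" .
    have "1 * 1 \<le> (1 + W / c) * (real n)\<^sup>2" using n2 W c by (intro mult_mono) auto
    then have h1: "A * (l / real m) \<le> 1" using h by (smt (verit) divide_le_eq_1)
    have "1 / ((1 + W / c) * (real n)\<^sup>2) \<le> 1 / (W / c * (real n)\<^sup>2)"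
      using W c n by (intro divide_left_mono mult_right_mono mult_pos_pos add_pos_pos divide_pos_pos) auto
    with h have h2: "A * (l / real m) \<le> c / (W * (real n)\<^sup>2)" by simp
    define P :: "('d \<Rightarrow> nat) \<Rightarrow> real ^ 'd" where "P k = (\<chi> r. a $ r + l * real (k r) / real m)" for k
    define X where "X = \<Union>\<K> \<inter> P ` exponents Maximum m"
    have near: "\<exists>y\<in>X. infnorm (y - z) \<le> c / (W * (real n)\<^sup>2)" if z: "z \<in> \<Union>\<K>" for z
    proof -
      obtain K where K: "K \<in> \<K>" "z \<in> K" using z by blast
      have le: "A' K * (l / real m) \<le> A * (l / real m)"
        using A_ge[OF K(1)] l by (intro mult_right_mono) auto
      obtain k where k: "\<forall>r. k r \<le> m" "P k \<in> K" "infnorm (P k - z) \<le> A' K * (l / real m)"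
        using A'(2)[OF K(1), unfolded near_grid_def, rule_format, OF m(3) order.trans[OF le h1] K(2)]
        unfolding P_def by blast
      then have "P k \<in> X" using K(1) by (auto simp: X_def)
      then show ?thesis using k(3) le h2 by (intro bexI[of _ "P k"]) auto
    qed
    have "equispaced_discretization (\<Union>\<K>) X"
      unfolding equispaced_discretization_def X_def P_def
      using l m(3) cube by (intro exI[of _ a] exI[of _ l] exI[of _ m]) auto
    moreover have "mesh_condition T n c \<K> X"
      unfolding mesh_condition_def
    proof (intro conjI ballI)
      obtain K z where "K \<in> \<K>" "z \<in> K"
        using \<K>(2,3) convex_body_contains_cball by (metis centre_in_cball ex_in_conv less_imp_le subsetD)
      then show "X \<noteq> {}" using near by blast
    next
      fix z assume "z \<in> \<Union>\<K>"
      then obtain y where "y \<in> X" "infnorm (y - z) \<le> c / (W * (real n)\<^sup>2)" using near by blast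
      then show "(INF y\<in>X. infnorm (y - z)) \<le> c / (markov_const T \<K> * (real n)\<^sup>2)"
        unfolding W_def
        by (intro cINF_lower2[of _ _ y]) (auto intro!: bdd_belowI[of _ 0] simp: infnorm_pos_le)
    qed
    moreover have fin: "finite X" unfolding X_def by (intro finite_Int disjI2 finite_imageI finite_exponents)
    moreover have "real (card X) \<le> (B + 2) ^ d * (real d ^ d)\<^sup>2 * (real (space_dim TYPE('d) T n))\<^sup>2"
    proof -
      have "card X \<le> card (P ` exponents Maximum m)"
        unfolding X_def by (intro card_mono finite_imageI finite_exponents) auto
      also have "\<dots> \<le> Suc m ^ d"
        unfolding d_def card_exponents_Maximum[symmetric] by (intro card_image_le finite_exponents)
      finally have "real (card X) \<le> (real m + 1) ^ d"
        by (metis of_nat_Suc of_nat_le_iff of_nat_power add.commute)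
      \<comment> \<open>One unit of the 2 comes from the ceiling in \<open>m\<close>, the other from
        the \<open>m + 1\<close> points per edge.\<close>
      also have "\<dots> \<le> ((B + 2) * (real n)\<^sup>2) ^ d"
        using m(2) n2 by (intro power_mono) (auto simp: distrib_right)
      also have "\<dots> = (B + 2) ^ d * (real n ^ d)\<^sup>2"
        by (simp add: power_mult_distrib flip: power_mult) (simp add: mult.commute)
      also have "\<dots> \<le> (B + 2) ^ d * (real d ^ d * real (space_dim TYPE('d) T n))\<^sup>2"
        using B power_le_space_dim[where 'd = 'd, of n T] unfolding d_def
        by (intro mult_left_mono power_mono) auto
      finally show ?thesis by (simp add: power_mult_distrib mult.assoc)
    qed
    ultimately show ?thesis by blast
  qed
  then show ?thesis by blast
qed

section \<open>From the samples to the sup norm on the domain\<close>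

lemma sup_norm_on_upper:
  assumes "compact \<Omega>" "continuous_on \<Omega> g" "z \<in> \<Omega>"
  shows "\<bar>g z\<bar> \<le> sup_norm_on \<Omega> g"
proof -
  have "compact ((\<lambda>z. \<bar>g z\<bar>) ` \<Omega>)"
    using assms by (intro compact_continuous_image continuous_intros)
  then have "bdd_above ((\<lambda>z. \<bar>g z\<bar>) ` \<Omega>)"
    by (intro bounded_imp_bdd_above compact_imp_bounded)
  then show ?thesis unfolding sup_norm_on_def using assms(3) by (intro cSUP_upper)
qed

text \<open>By the norming property the polynomial vanishes on the whole domain, which contains a
  ball.\<close>

lemma mesh_determines_polynomial:
  fixes \<K> :: "(real ^ 'd::finite) set set"
  assumes \<K>: "finite \<K>" "\<K> \<noteq> {}" "\<And>K. K \<in> \<K> \<Longrightarrow> convex_body K"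
    and c: "0 < c" "c \<le> 1 / (2 * sqrt (real CARD('d)))" and n: "n \<ge> 1"
    and mesh: "mesh_condition T n c \<K> X" "finite X"
    and p: "p \<in> poly_space T n" and zero: "\<And>y. y \<in> X \<Longrightarrow> p y = 0"
  shows "p = (\<lambda>_. 0)"
proof
  fix z
  obtain K where K: "K \<in> \<K>" using \<K>(2) by blast
  obtain x e where x: "e > 0" "cball x e \<subseteq> K" using convex_body_contains_cball \<K>(3)[OF K] by blast
  have "p y = 0" if "y \<in> ball x e" for y
  proof -
    have "y \<in> cball x e" using that by simp
    then have "y \<in> \<Union>\<K>" using x(2) K by blast
    then show ?thesis using norming_mesh[OF \<K>(1,3) c n mesh p] zero by fastforce
  qed
  then show "p z = 0" using poly_fun_zero_on_ball[OF poly_space_poly_fun[OF p] x(1)] by blast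
qed

text \<open>The factor 2 in front of the row sum norm is the norming constant, paid in passing from
  samples to \<open>\<Omega>\<close>. The row sum bound makes the whole term at most
  \<open>2 * sqrt M\<close>, and \<open>M <= C * N^2\<close> turns this into
  \<open>2 * sqrt C * N\<close>.\<close>

lemma least_squares_error_bounds:
  fixes \<K> :: "(real ^ 'd::finite) set set"
  assumes c: "0 < c" "c \<le> 1 / (2 * sqrt (real CARD('d)))"
    and \<K>: "finite \<K>" "\<K> \<noteq> {}" "\<And>K. K \<in> \<K> \<Longrightarrow> convex_body K" and \<Omega>: "\<Omega> = \<Union>\<K>"
    and f: "continuous_on \<Omega> f" and n: "n \<ge> 1" and N: "N = space_dim TYPE('d) T n"
    and p: "p \<in> poly_space T n" and X: "X \<subseteq> \<Omega>" and mesh: "mesh_condition T n c \<K> X"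
    and bij: "bij_betw x {..<M} X" and MC: "real M \<le> C * (real N)\<^sup>2"
    and va: "va_basis T n M x \<alpha> \<phi>" and Q: "Q = Q_matrix M N x \<phi>"
    and ls: "least_squares_approx T n M x f Lf"
  shows "sup_norm_on \<Omega> (\<lambda>z. f z - Lf z)
      \<le> (1 + 2 / real M * row_sum_norm (Q * transpose_mat Q)) * sup_norm_on \<Omega> (\<lambda>z. f z - p z)"
    and "(1 + 2 / real M * row_sum_norm (Q * transpose_mat Q)) * sup_norm_on \<Omega> (\<lambda>z. f z - p z)
      \<le> (1 + 2 * sqrt C * real N) * sup_norm_on \<Omega> (\<lambda>z. f z - p z)"
proof -
  define E where "E = sup_norm_on \<Omega> (\<lambda>z. f z - p z)"
  define R where "R = row_sum_norm (Q * transpose_mat Q)"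
  have fin: "finite X" using bij bij_betw_finite by blast
  have xX: "x i \<in> X" if "i < M" for i using bij that by (auto simp: bij_betw_def)
  have "X \<noteq> {}" using mesh by (simp add: mesh_condition_def)
  then have M: "M \<ge> 1" using bij by (cases M) (auto simp: bij_betw_def)
  then have M0: "real M > 0" by simp
  have comp: "compact \<Omega>" unfolding \<Omega> using \<K> by (auto simp: convex_body_def intro: compact_Union)
  have cont: "continuous_on \<Omega> (\<lambda>z. f z - p z)"
    using f continuous_on_poly_fun[OF poly_space_poly_fun[OF p]] by (intro continuous_intros)
  have E_upper: "\<bar>f z - p z\<bar> \<le> E" if "z \<in> \<Omega>" for z
    unfolding E_def using sup_norm_on_upper[OF comp cont that] .
  have ne: "\<Omega> \<noteq> {}" using X \<open>X \<noteq> {}\<close> by blast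
  then have E0: "E \<ge> 0" using E_upper by fastforce
  have nondeg: "\<forall>q\<in>poly_space T n. (\<forall>i<M. q (x i) = 0) \<longrightarrow> q = (\<lambda>_. 0)"
    using bij by (intro ballI impI mesh_determines_polynomial[OF \<K> c n mesh fin]) (auto simp: bij_betw_def)
  note basis = va_basis_orthonormal_spanning[OF va N M nondeg]
  have Lf: "Lf \<in> poly_space T n"
    using ls by (simp add: least_squares_approx_def is_arg_min_def)
  have sample: "\<bar>Lf (x k) - p (x k)\<bar> \<le> R / real M * E" if "k < M" for k
    unfolding R_def Q using xX X that
    by (intro least_squares_sample_error[OF M basis ls p]) (auto intro: E_upper)
  show "sup_norm_on \<Omega> (\<lambda>z. f z - Lf z) \<le> (1 + 2 / real M * R) * E"
    unfolding sup_norm_on_def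
  proof (rule cSUP_least[OF ne])
    fix z assume z: "z \<in> \<Omega>"
    obtain y where y: "y \<in> X" "\<bar>Lf z - p z\<bar> \<le> 2 * \<bar>Lf y - p y\<bar>"
      using norming_mesh[OF \<K>(1,3) c n mesh fin poly_space_diff[OF Lf p]] z \<Omega> by blast
    obtain k where "k < M" "y = x k" using y(1) bij by (auto simp: bij_betw_def)
    with sample[of k] y(2) have "\<bar>Lf z - p z\<bar> \<le> 2 * (R / real M * E)" by simp
    then have "\<bar>f z - Lf z\<bar> \<le> E + 2 * (R / real M * E)" using E_upper[OF z] by linarith
    then show "\<bar>f z - Lf z\<bar> \<le> (1 + 2 / real M * R) * E" by (simp add: algebra_simps)
  qed
  have "R \<le> real M * sqrt (real M)"
    unfolding R_def Q using basis(1) by (intro row_sum_norm_gram_le[OF M])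
  then have "2 / real M * R \<le> 2 / real M * (real M * sqrt (real M))"
    using M0 by (intro mult_left_mono) auto
  also have "\<dots> = 2 * sqrt (real M)" using M0 by simp
  also have "\<dots> \<le> 2 * sqrt (C * (real N)\<^sup>2)" using MC by simp
  also have "\<dots> = 2 * sqrt C * real N" by (simp add: real_sqrt_mult)
  finally show "(1 + 2 / real M * R) * E \<le> (1 + 2 * sqrt C * real N) * E"
    using E0 by (intro mult_right_mono) auto
qed

theorem theorem4p4:
  assumes "CARD('d::finite) > 1"
  shows
    "(\<forall>T c (\<K> :: (real ^ 'd) set set).
        0 < c \<and> c \<le> 1 / (2 * sqrt (real CARD('d))) \<and>
        finite \<K> \<and> \<K> \<noteq> {} \<and> (\<forall>K\<in>\<K>. convex_body K) \<longrightarrow>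
        (\<exists>C. \<forall>n\<ge>1. \<exists>X.
           equispaced_discretization (\<Union>\<K>) X \<and> mesh_condition T n c \<K> X \<and>
           finite X \<and> real (card X) \<le> C * (real (space_dim TYPE('d) T n))\<^sup>2))
     \<and>
     (\<forall>C. \<exists>C'. \<forall>T c (\<K> :: (real ^ 'd) set set) \<Omega> f n pstar X M N x \<alpha> \<phi> Lf Q.
        0 < c \<and> c \<le> 1 / (2 * sqrt (real CARD('d))) \<and>
        finite \<K> \<and> \<K> \<noteq> {} \<and> (\<forall>K\<in>\<K>. convex_body K) \<and> \<Omega> = \<Union>\<K> \<and>
        continuous_on \<Omega> f \<and>
        n \<ge> 1 \<and> N = space_dim TYPE('d) T n \<and>
        best_approx T n \<Omega> f pstar \<and>
        equispaced_discretization \<Omega> X \<and> mesh_condition T n c \<K> X \<and>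
        bij_betw x {..<M} X \<and> real M \<le> C * (real N)\<^sup>2 \<and>
        va_basis T n M x \<alpha> \<phi> \<and> Q = Q_matrix M N x \<phi> \<and>
        least_squares_approx T n M x f Lf \<longrightarrow>
        sup_norm_on \<Omega> (\<lambda>z. f z - Lf z)
          \<le> (1 + 2 / real M * row_sum_norm (Q * transpose_mat Q)) * sup_norm_on \<Omega> (\<lambda>z. f z - pstar z) \<and>
        (1 + 2 / real M * row_sum_norm (Q * transpose_mat Q)) * sup_norm_on \<Omega> (\<lambda>z. f z - pstar z)
          \<le> (1 + C' * real N) * sup_norm_on \<Omega> (\<lambda>z. f z - pstar z))"
proof (intro conjI allI impI)
  fix T c and \<K> :: "(real ^ 'd) set set"
  assume "0 < c \<and> c \<le> 1 / (2 * sqrt (real CARD('d))) \<and>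
    finite \<K> \<and> \<K> \<noteq> {} \<and> (\<forall>K\<in>\<K>. convex_body K)"
  then show "\<exists>C. \<forall>n\<ge>1. \<exists>X. equispaced_discretization (\<Union>\<K>) X \<and> mesh_condition T n c \<K> X \<and>
      finite X \<and> real (card X) \<le> C * (real (space_dim TYPE('d) T n))\<^sup>2"
    by (intro exists_equispaced_mesh) auto
next
  fix C
  show "\<exists>C'. \<forall>T c (\<K> :: (real ^ 'd) set set) \<Omega> f n pstar X M N x \<alpha> \<phi> Lf Q.
        0 < c \<and> c \<le> 1 / (2 * sqrt (real CARD('d))) \<and>
        finite \<K> \<and> \<K> \<noteq> {} \<and> (\<forall>K\<in>\<K>. convex_body K) \<and> \<Omega> = \<Union>\<K> \<and>
        continuous_on \<Omega> f \<and>
        n \<ge> 1 \<and> N = space_dim TYPE('d) T n \<and>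
        best_approx T n \<Omega> f pstar \<and>
        equispaced_discretization \<Omega> X \<and> mesh_condition T n c \<K> X \<and>
        bij_betw x {..<M} X \<and> real M \<le> C * (real N)\<^sup>2 \<and>
        va_basis T n M x \<alpha> \<phi> \<and> Q = Q_matrix M N x \<phi> \<and>
        least_squares_approx T n M x f Lf \<longrightarrow>
        sup_norm_on \<Omega> (\<lambda>z. f z - Lf z)
          \<le> (1 + 2 / real M * row_sum_norm (Q * transpose_mat Q)) * sup_norm_on \<Omega> (\<lambda>z. f z - pstar z) \<and>
        (1 + 2 / real M * row_sum_norm (Q * transpose_mat Q)) * sup_norm_on \<Omega> (\<lambda>z. f z - pstar z)
          \<le> (1 + C' * real N) * sup_norm_on \<Omega> (\<lambda>z. f z - pstar z)"
    (is "\<exists>C'. \<forall>T c \<K> \<Omega> f n pstar X M N x \<alpha> \<phi> Lf Q.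
      ?H T c \<K> \<Omega> f n pstar X M N x \<alpha> \<phi> Lf Q \<longrightarrow> ?P \<Omega> f pstar M N Lf Q C'")
  \<comment> \<open>The witness depends on \<open>C\<close> only, so the bound is uniform in the
    domain, the function and the degree.\<close>
  proof (intro exI[of _ "2 * sqrt C"] allI impI)
    fix T c and \<K> :: "(real ^ 'd) set set" and \<Omega> f n pstar X M N x \<alpha> \<phi> Lf Q
    assume H: "?H T c \<K> \<Omega> f n pstar X M N x \<alpha> \<phi> Lf Q"
    then have pX: "pstar \<in> poly_space T n" "X \<subseteq> \<Omega>"
      by (auto simp: best_approx_def equispaced_discretization_def)
    show "?P \<Omega> f pstar M N Lf Q (2 * sqrt C)"
      by (intro conjI least_squares_error_bounds[where T = T and \<K> = \<K> and x = x and \<alpha> = \<alpha> and \<phi> = \<phi>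
            and X = X and C = C and c = c and n = n and N = N and M = M])
        (use H pX in blast)+
  qed
qed

end
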